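(* Fix any dimension $d\ge 2$. It is undecidable to determine, given two correlation-free cellular automata (CFCA) $F$ and $G$ of dimension $d$, whether $\mathcal{S}_F^2=\mathcal{S}_G^2$.
   Context: A stochastic cellular automaton of dimension $d$ is a tuple $\mathcal{A}=(Q,R,V,V',f)$ where $Q$ (states) and $R$ (random symbols) are finite sets, $V=\{v_1,\dots,v_\rho\}$ and $V'=\{v'_1,\dots,v'_{\rho'}\}$ are finite subsets of $\mathbb{Z}^d$, and $f:Q^\rho\times R^{\rho'}\to Q$ is the local function. It is a correlation-free CA (CFCA) if $V'=\{0\}$. It is identified with its explicit global function $F:Q^{\mathbb{Z}^d}\times R^{\mathbb{Z}^d}\to Q^{\mathbb{Z}^d}$, $F(c,s)_z=f\big((c_{z+v_j})_j,(s_{z+v'_j})_j\big)$. Iterates: $F^0(c)=c$ and $F^{t+1}(c,s^1,\dots,s^{t+1})=F(F^t(c,s^1,\dots,s^t),s^{t+1})$. $\mathcal{S}_F^t(c)$ is the law of $F^t(c,s^1,\dots,s^t)$ when $s^1,\dots,s^t$ are independent and each drawn from the uniform (i.i.d. uniform product) measure on $R^{\mathbb{Z}^d}$. CA are given as inputs by their finite description $(Q,R,V,V',f)$. *)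

theory Defs
  imports "HOL-Probability.Probability" "HOL-Library.Nat_Bijection"
begin

section \<open>Partial recursive functions\<close>

text \<open>
  Terms for Kleene's partial recursive functions and their graph. Arities are not tracked: a term
  applied to more arguments than it needs ignores the rest, and it has no value on an argument
  list that is too short. In primitive recursion and minimisation the recursion (search) variable
  is the first argument.
\<close>

datatype recf =
    Zero
  | Succ
  | Proj nat
  | Comp recf "recf list"
  | PrimRec recf recf
  | Mini recf

inductive computes :: "recf \<Rightarrow> nat list \<Rightarrow> nat \<Rightarrow> bool" where
  zero: "computes Zero xs 0"
| succ: "computes Succ (x # xs) (Suc x)"
| proj: "i < length xs \<Longrightarrow> computes (Proj i) xs (xs ! i)"
| comp: "length ys = length gs \<Longrightarrow> (\<And>i. i < length gs \<Longrightarrow> computes (gs ! i) xs (ys ! i))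
    \<Longrightarrow> computes f ys z \<Longrightarrow> computes (Comp f gs) xs z"
| prim_0: "computes f xs y \<Longrightarrow> computes (PrimRec f g) (0 # xs) y"
| prim_Suc: "computes (PrimRec f g) (n # xs) y \<Longrightarrow> computes g (n # y # xs) z
    \<Longrightarrow> computes (PrimRec f g) (Suc n # xs) z"
| mini: "computes f (n # xs) 0 \<Longrightarrow> (\<And>i. i < n \<Longrightarrow> \<exists>y. computes f (i # xs) (Suc y))
    \<Longrightarrow> computes (Mini f) xs n"

inductive_cases computes_elims:
  "computes Zero xs y"
  "computes Succ (x # xs) y"
  "computes (Proj i) xs y"
  "computes (Comp f gs) xs y"
  "computes (PrimRec f g) (0 # xs) y"
  "computes (PrimRec f g) (Suc n # xs) y"
  "computes (Mini f) xs y"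

lemma computes_unique: "computes p xs y \<Longrightarrow> computes p xs z \<Longrightarrow> y = z"
proof (induction p xs y arbitrary: z rule: computes.induct)
  case (zero xs)
  then show ?case by (rule computes_elims(1)) simp
next
  case (succ x xs)
  then show ?case by (rule computes_elims(2)) simp
next
  case (proj i xs)
  from proj.prems show ?case by (rule computes_elims(3)) simp
next
  case (comp ys gs xs f w)
  from comp.prems obtain ys' where ys': "length ys' = length gs"
    "\<And>i. i < length gs \<Longrightarrow> computes (gs ! i) xs (ys' ! i)" "computes f ys' z"
    by (rule computes_elims(4)) (rule that; blast)
  have "ys = ys'"
  proof (rule nth_equalityI)
    show "length ys = length ys'" using comp.hyps ys'(1) by simp
    show "ys ! i = ys' ! i" if "i < length ys" for i
      using comp.IH(1) ys'(2) comp.hyps(1) that by metis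
  qed
  then show ?case using comp.IH(2) ys'(3) by metis
next
  case (prim_0 f xs y g)
  from prim_0.prems have "computes f xs z" by (rule computes_elims(5))
  then show ?case by (rule prim_0.IH)
next
  case (prim_Suc f g n xs y w)
  from prim_Suc.prems obtain y' where "computes (PrimRec f g) (n # xs) y'"
    "computes g (n # y' # xs) z"
    by (rule computes_elims(6))
  then show ?case using prim_Suc.IH by metis
next
  case (mini f n xs)
  from mini.prems have z0: "computes f (z # xs) 0"
    by (rule computes_elims(7))
  have z1: "\<exists>y. computes f (i # xs) (Suc y)" if "i < z" for i
    using mini.prems by (rule computes_elims(7)) (use that in blast)
  show ?case
  proof (rule linorder_cases[of n z])
    assume "n < z"
    then show ?thesis using mini.IH(1) z1 by (metis nat.distinct(1))
  next
    assume "z < n"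
    then show ?thesis using mini.IH(2) z0 by (metis nat.distinct(1))
  qed
qed

text \<open>
  A decision problem consists of a set \<open>I\<close> of instances, a coding \<open>e\<close> of the instances by natural
  numbers and the property \<open>P\<close> to be determined. Nothing is required of the algorithm on numbers
  which are not codes of instances.
\<close>

definition decidable_problem :: "('i \<Rightarrow> nat) \<Rightarrow> 'i set \<Rightarrow> ('i \<Rightarrow> bool) \<Rightarrow> bool" where
  "decidable_problem e I P \<longleftrightarrow>
     (\<exists>p. \<forall>x\<in>I. computes p [e x] (if P x then 1 else 0))"


section \<open>Stochastic cellular automata\<close>

definition lattice_pts :: "nat \<Rightarrow> int list set" where
  "lattice_pts d = {z. length z = d}"

definition vadd :: "int list \<Rightarrow> int list \<Rightarrow> int list" where
  "vadd u v = map2 (+) u v"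

text \<open>
  The neighbourhoods \<open>V\<close> and \<open>V'\<close> are finite sets listed without repetition; the arguments of the
  local function are lists of states and of random symbols, in the order of these listings.
\<close>

record ('q, 'r) sca =
  states :: "'q set"
  rsyms :: "'r set"
  nbhd :: "int list list"
  rnbhd :: "int list list"
  locfun :: "'q list \<Rightarrow> 'r list \<Rightarrow> 'q"

definition is_sca :: "nat \<Rightarrow> ('q, 'r) sca \<Rightarrow> bool" where
  "is_sca d A \<longleftrightarrow>
     finite (states A) \<and> finite (rsyms A) \<and> rsyms A \<noteq> {} \<and>
     distinct (nbhd A) \<and> set (nbhd A) \<subseteq> lattice_pts d \<and>
     distinct (rnbhd A) \<and> set (rnbhd A) \<subseteq> lattice_pts d \<and>
     (\<forall>x y. length x = length (nbhd A) \<longrightarrow> set x \<subseteq> states A \<longrightarrow>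
            length y = length (rnbhd A) \<longrightarrow> set y \<subseteq> rsyms A \<longrightarrow> locfun A x y \<in> states A)"

definition is_cfca :: "nat \<Rightarrow> ('q, 'r) sca \<Rightarrow> bool" where
  "is_cfca d A \<longleftrightarrow> is_sca d A \<and> set (rnbhd A) = {replicate d 0}"

definition configs :: "nat \<Rightarrow> ('q, 'r) sca \<Rightarrow> (int list \<Rightarrow> 'q) set" where
  "configs d A = lattice_pts d \<rightarrow>\<^sub>E states A"

definition global :: "nat \<Rightarrow> ('q, 'r) sca \<Rightarrow> (int list \<Rightarrow> 'q) \<Rightarrow> (int list \<Rightarrow> 'r) \<Rightarrow> int list \<Rightarrow> 'q" where
  "global d A c s = (\<lambda>z\<in>lattice_pts d.
     locfun A (map (\<lambda>v. c (vadd z v)) (nbhd A)) (map (\<lambda>v. s (vadd z v)) (rnbhd A)))"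

primrec iterate ::
  "nat \<Rightarrow> ('q, 'r) sca \<Rightarrow> nat \<Rightarrow> (int list \<Rightarrow> 'q) \<Rightarrow> (nat \<Rightarrow> int list \<Rightarrow> 'r) \<Rightarrow> int list \<Rightarrow> 'q" where
  "iterate d A 0 c s = c"
| "iterate d A (Suc t) c s = global d A (iterate d A t c s) (s (Suc t))"

definition config_space :: "nat \<Rightarrow> ('q, 'r) sca \<Rightarrow> (int list \<Rightarrow> 'q) measure" where
  "config_space d A = PiM (lattice_pts d) (\<lambda>_. count_space (states A))"

definition uniform_rand :: "nat \<Rightarrow> ('q, 'r) sca \<Rightarrow> (int list \<Rightarrow> 'r) measure" where
  "uniform_rand d A = PiM (lattice_pts d) (\<lambda>_. uniform_count_measure (rsyms A))"

definition stoch_map ::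
  "nat \<Rightarrow> ('q, 'r) sca \<Rightarrow> nat \<Rightarrow> (int list \<Rightarrow> 'q) \<Rightarrow> (int list \<Rightarrow> 'q) measure" where
  "stoch_map d A t c =
     distr (PiM {1..t} (\<lambda>_. uniform_rand d A)) (config_space d A) (\<lambda>s. iterate d A t c s)"

text \<open>
  Equality of \<open>stoch_map d A t\<close> and \<open>stoch_map d B t\<close> as functions on configurations; it includes
  equality of the domains, hence of the state sets.
\<close>

definition same_stoch_map :: "nat \<Rightarrow> nat \<Rightarrow> ('q, 'r) sca \<Rightarrow> ('q, 's) sca \<Rightarrow> bool" where
  "same_stoch_map d t A B \<longleftrightarrow>
     states A = states B \<and> (\<forall>c\<in>configs d A. stoch_map d A t c = stoch_map d B t c)"


section \<open>Finite descriptions\<close>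

text \<open>
  As inputs, automata have natural numbers as states and random symbols, which are listed in
  increasing order. The local function is coded by the list of its values on
  \<^term>\<open>states A\<close> to the power \<^term>\<open>length (nbhd A)\<close> times \<^term>\<open>rsyms A\<close> to the power
  \<^term>\<open>length (rnbhd A)\<close>; it is irrelevant elsewhere.
\<close>

definition vec_code :: "int list \<Rightarrow> nat" where
  "vec_code v = list_encode (map int_encode v)"

definition rule_table :: "(nat, nat) sca \<Rightarrow> nat list" where
  "rule_table A =
     map (\<lambda>(x, y). locfun A x y)
       (List.product (List.n_lists (length (nbhd A)) (sorted_list_of_set (states A)))
                     (List.n_lists (length (rnbhd A)) (sorted_list_of_set (rsyms A))))"

definition sca_code :: "(nat, nat) sca \<Rightarrow> nat" where
  "sca_code A = list_encode
     [list_encode (sorted_list_of_set (states A)),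
      list_encode (sorted_list_of_set (rsyms A)),
      list_encode (map vec_code (nbhd A)),
      list_encode (map vec_code (rnbhd A)),
      list_encode (rule_table A)]"

lemma sca_code_determines:
  assumes A: "is_sca d A" and B: "is_sca d B" and eq: "sca_code A = sca_code B"
  shows "states A = states B" "rsyms A = rsyms B" "nbhd A = nbhd B" "rnbhd A = rnbhd B"
    and "\<And>x y. \<lbrakk>length x = length (nbhd A); set x \<subseteq> states A;
               length y = length (rnbhd A); set y \<subseteq> rsyms A\<rbrakk> \<Longrightarrow> locfun A x y = locfun B x y"
proof -
  have inj_vec: "inj vec_code"
    by (rule injI) (simp add: vec_code_def list_encode_eq inj_map_eq_map inj_int_encode)
  have fin: "finite (states A)" "finite (states B)" "finite (rsyms A)" "finite (rsyms B)"
    using A B by (auto simp: is_sca_def)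
  have e: "sorted_list_of_set (states A) = sorted_list_of_set (states B)"
    "sorted_list_of_set (rsyms A) = sorted_list_of_set (rsyms B)"
    "map vec_code (nbhd A) = map vec_code (nbhd B)"
    "map vec_code (rnbhd A) = map vec_code (rnbhd B)"
    "rule_table A = rule_table B"
    using eq unfolding sca_code_def by (simp_all add: list_encode_eq)
  show st: "states A = states B" and rs: "rsyms A = rsyms B"
    using e(1,2) fin by (metis set_sorted_list_of_set)+
  show nb: "nbhd A = nbhd B" and rn: "rnbhd A = rnbhd B"
    using e(3,4) by (simp_all add: inj_map_eq_map[OF inj_vec])
  show "locfun A x y = locfun B x y"
    if "length x = length (nbhd A)" "set x \<subseteq> states A" "length y = length (rnbhd A)" "set y \<subseteq> rsyms A" for x y
    using e(5) that fin unfolding rule_table_def nb[symmetric] rn[symmetric] st[symmetric] rs[symmetric]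
    by (auto simp: set_n_lists)
qed

end

theory Submission
  imports Defs
begin

text \<open>
  Every configuration induces a functional graph on pairs of a cell and a layer: from a vertex, a
  walker moves to a neighbouring vertex as prescribed by the labels nearby. At time 1 each vertex
  receives a random bit, and at time 2 the automaton \<open>F\<close> shows at each vertex the sum of its bit and
  of the bit of its successor, while \<open>G\<close> moreover flips the values on the layer \<open>Jump\<close>. On a cycle of
  the graph the values of \<open>F\<close> add up to 0, so a cycle with a single vertex on the layer \<open>Jump\<close>
  distinguishes \<open>F\<close> and \<open>G\<close>; if no such vertex lies on a cycle, the flips can be absorbed by a
  translation of the random bits, which preserves the uniform measure.

  The walker traverses a rectangle row by row and checks that the labels form the space-time diagram
  of an accepting run of a nondeterministic register program. The input \<open>m\<close> of the program enters only
  through one vector \<open>(m, 0, \<dots>)\<close> of the neighbourhood: the walker starts with a jump by this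
  vector and returns to the left end of the row. It can close a cycle only if this left end is its
  starting point, hence only if the first register has the value \<open>m\<close>.

  Since the state set and the rule table do not depend on \<open>m\<close>, a program which simulates an alleged
  decision procedure can be run on an \<open>m\<close> which encodes the state set and the rule tables of its own
  automata; accepting iff the procedure answers that the laws agree, it refutes the procedure.
\<close>

section \<open>Register programs\<close>

text \<open>\<open>Eq\<close> is a test that blocks when it fails. Instead of branching and
  decrementing, programs guess values and test them, so that every instruction can be checked
  locally on values written in unary.\<close>

datatype instr = Zer nat | Inc nat | Eq nat nat

datatype com = Skip | Prim instr | Seq com com | Loop com

type_synonym store = "nat \<Rightarrow> nat"

primrec exec :: "instr \<Rightarrow> store \<Rightarrow> store option" where
  "exec (Zer r) \<sigma> = Some (\<sigma>(r := 0))"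
| "exec (Inc r) \<sigma> = Some (\<sigma>(r := Suc (\<sigma> r)))"
| "exec (Eq r s) \<sigma> = (if \<sigma> r = \<sigma> s then Some \<sigma> else None)"

primrec run :: "com \<Rightarrow> (store \<times> store) set" where
  "run Skip = Id"
| "run (Prim i) = {(\<sigma>, \<tau>). exec i \<sigma> = Some \<tau>}"
| "run (Seq c e) = run c O run e"
| "run (Loop c) = (run c)\<^sup>*"

lemma exec_Eq [simp]: "exec (Eq r s) \<sigma> = Some \<tau> \<longleftrightarrow> \<sigma> r = \<sigma> s \<and> \<tau> = \<sigma>"
  by auto

lemma in_run [simp]:
  "(\<sigma>, \<tau>) \<in> run Skip \<longleftrightarrow> \<tau> = \<sigma>"
  "(\<sigma>, \<tau>) \<in> run (Prim i) \<longleftrightarrow> exec i \<sigma> = Some \<tau>"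
  "(\<sigma>, \<tau>) \<in> run (Seq c e) \<longleftrightarrow> (\<exists>\<rho>. (\<sigma>, \<rho>) \<in> run c \<and> (\<rho>, \<tau>) \<in> run e)"
  "(\<sigma>, \<tau>) \<in> run (Loop c) \<longleftrightarrow> (\<sigma>, \<tau>) \<in> (run c)\<^sup>*"
  by auto

declare run.simps [simp del] exec.simps(3) [simp del]

definition guess :: "nat \<Rightarrow> com" where
  "guess r = Seq (Prim (Zer r)) (Loop (Prim (Inc r)))"

text \<open>There is no copying instruction: the value is guessed, and a wrong guess blocks.\<close>

definition copy :: "nat \<Rightarrow> nat \<Rightarrow> com" where
  "copy a r = Seq (guess r) (Prim (Eq a r))"

definition is_zero :: "nat \<Rightarrow> nat \<Rightarrow> com" where
  "is_zero v t = Seq (Prim (Zer t)) (Prim (Eq v t))"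

definition is_pos :: "nat \<Rightarrow> nat \<Rightarrow> com" where
  "is_pos v t = Seq (guess t) (Seq (Prim (Inc t)) (Prim (Eq v t)))"

text \<open>A program without runs, matching the absence of a value when an argument list is too
  short.\<close>

definition block :: "nat \<Rightarrow> com" where
  "block r = Seq (Prim (Zer r)) (is_pos r (Suc r))"

lemma run_guess [simp]: "(\<sigma>, \<tau>) \<in> run (guess r) \<longleftrightarrow> (\<exists>n. \<tau> = \<sigma>(r := n))"
proof -
  have loop: "(\<sigma>, \<tau>) \<in> (run (Prim (Inc r)))\<^sup>* \<longleftrightarrow> (\<exists>n. \<tau> = \<sigma>(r := \<sigma> r + n))" for \<sigma> \<tau>
  proof
    assume "(\<sigma>, \<tau>) \<in> (run (Prim (Inc r)))\<^sup>*"
    then show "\<exists>n. \<tau> = \<sigma>(r := \<sigma> r + n)"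
    proof (induction rule: rtrancl_induct)
      case base
      show ?case by (rule exI[of _ 0]) simp
    next
      case (step \<tau> \<tau>')
      then obtain n where "\<tau> = \<sigma>(r := \<sigma> r + n)" by blast
      with step have "\<tau>' = \<sigma>(r := \<sigma> r + Suc n)" by simp
      then show ?case by blast
    qed
  next
    have "(\<sigma>, \<sigma>(r := \<sigma> r + n)) \<in> (run (Prim (Inc r)))\<^sup>*" for n
    proof (induction n)
      case (Suc n)
      have "(\<sigma>(r := \<sigma> r + n), \<sigma>(r := \<sigma> r + Suc n)) \<in> run (Prim (Inc r))" by simp
      with Suc show ?case by (rule rtrancl_into_rtrancl)
    qed simp
    then show "\<exists>n. \<tau> = \<sigma>(r := \<sigma> r + n) \<Longrightarrow> (\<sigma>, \<tau>) \<in> (run (Prim (Inc r)))\<^sup>*" by blast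
  qed
  show ?thesis by (simp add: guess_def loop)
qed

lemma run_copy [simp]: "a \<noteq> r \<Longrightarrow> (\<sigma>, \<tau>) \<in> run (copy a r) \<longleftrightarrow> \<tau> = \<sigma>(r := \<sigma> a)"
  by (auto simp: copy_def)

lemma run_is_zero [simp]: "v \<noteq> t \<Longrightarrow> (\<sigma>, \<tau>) \<in> run (is_zero v t) \<longleftrightarrow> \<sigma> v = 0 \<and> \<tau> = \<sigma>(t := 0)"
  by (simp add: is_zero_def)

lemma run_is_pos [simp]:
  assumes "v \<noteq> t"
  shows "(\<sigma>, \<tau>) \<in> run (is_pos v t) \<longleftrightarrow> \<sigma> v > 0 \<and> \<tau> = \<sigma>(t := \<sigma> v)"
proof -
  have ex: "(\<exists>\<rho>. (\<exists>n. \<rho> = \<sigma>(t := n)) \<and> P \<rho>) \<longleftrightarrow> (\<exists>n. P (\<sigma>(t := n)))" for P by auto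
  show ?thesis using assms by (auto simp: is_pos_def ex gr0_conv_Suc)
qed

lemma run_block [simp]: "(\<sigma>, \<tau>) \<notin> run (block r)"
  by (simp add: block_def)

section \<open>Compilation of partial recursive functions into register programs\<close>

primrec seqs :: "com list \<Rightarrow> com" where
  "seqs [] = Skip"
| "seqs (c # cs) = Seq c (seqs cs)"

text \<open>
  \<open>compile f as r k\<close> evaluates \<open>f\<close> on the registers \<open>as\<close> into register \<open>r\<close>, using the registers
  from \<open>k\<close> on as workspace.
\<close>

primrec compile :: "recf \<Rightarrow> nat list \<Rightarrow> nat \<Rightarrow> nat \<Rightarrow> com" where
  "compile Zero as r k = Prim (Zer r)"
| "compile Succ as r k = (case as of [] \<Rightarrow> block k | a # _ \<Rightarrow> Seq (copy a r) (Prim (Inc r)))"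
| "compile (Proj i) as r k = (if i < length as then copy (as ! i) r else block k)"
| "compile (Comp f gs) as r k =
     Seq (seqs (map2 (\<lambda>C j. C as (k + j) (k + length gs)) (map compile gs) [0..<length gs]))
         (compile f [k..<k + length gs] r (k + length gs))"
| "compile (PrimRec f g) as r k = (case as of [] \<Rightarrow> block k | n # xs \<Rightarrow>
     seqs [compile f xs (k + 1) (k + 3), Prim (Zer k),
           Loop (seqs [compile g (k # (k + 1) # xs) (k + 2) (k + 3), copy (k + 2) (k + 1), Prim (Inc k)]),
           Prim (Eq k n), copy (k + 1) r])"
| "compile (Mini f) as r k =
     seqs [Prim (Zer k),
           Loop (seqs [compile f (k # as) (k + 1) (k + 3), is_pos (k + 1) (k + 2), Prim (Inc k)]),
           compile f (k # as) (k + 1) (k + 3), is_zero (k + 1) (k + 2), copy k r]"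

text \<open>Nondeterminism splits correctness in two: every completed run yields a correct value and
  changes only \<open>r\<close> among the registers below \<open>k\<close>, and every value is
  attained by some run. Wrong guesses and divergence leave no completed run, so undefined values
  correspond to programs without runs.\<close>

definition realises :: "(nat list \<Rightarrow> nat \<Rightarrow> nat \<Rightarrow> com) \<Rightarrow> (nat list \<Rightarrow> nat \<Rightarrow> bool) \<Rightarrow> bool" where
  "realises C X \<longleftrightarrow> (\<forall>as r k. set as \<subseteq> {..<k} \<longrightarrow> r < k \<longrightarrow> r \<notin> set as \<longrightarrow>
     (\<forall>\<sigma> \<tau>. (\<sigma>, \<tau>) \<in> run (C as r k) \<longrightarrow>
        X (map \<sigma> as) (\<tau> r) \<and> (\<forall>q<k. q \<noteq> r \<longrightarrow> \<tau> q = \<sigma> q)) \<and>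
     (\<forall>\<sigma> y. X (map \<sigma> as) y \<longrightarrow> (\<exists>\<tau>. (\<sigma>, \<tau>) \<in> run (C as r k) \<and> \<tau> r = y)))"

lemma realisesI:
  assumes "\<And>as r k \<sigma> \<tau>. set as \<subseteq> {..<k} \<Longrightarrow> r < k \<Longrightarrow> r \<notin> set as \<Longrightarrow> (\<sigma>, \<tau>) \<in> run (C as r k) \<Longrightarrow>
      X (map \<sigma> as) (\<tau> r) \<and> (\<forall>q<k. q \<noteq> r \<longrightarrow> \<tau> q = \<sigma> q)"
    and "\<And>as r k \<sigma> y. set as \<subseteq> {..<k} \<Longrightarrow> r < k \<Longrightarrow> r \<notin> set as \<Longrightarrow> X (map \<sigma> as) y \<Longrightarrow>
      \<exists>\<tau>. (\<sigma>, \<tau>) \<in> run (C as r k) \<and> \<tau> r = y"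
  shows "realises C X"
  unfolding realises_def by (intro allI impI conjI; (rule assms)?) (use assms(1) in \<open>blast+\<close>)

lemma
  assumes "realises C X" "set as \<subseteq> {..<k}" "r < k" "r \<notin> set as"
  shows realises_sound: "(\<sigma>, \<tau>) \<in> run (C as r k) \<Longrightarrow> X (map \<sigma> as) (\<tau> r)"
    and realises_frame: "(\<sigma>, \<tau>) \<in> run (C as r k) \<Longrightarrow> q < k \<Longrightarrow> q \<noteq> r \<Longrightarrow> \<tau> q = \<sigma> q"
    and realises_complete: "X (map \<sigma> as) y \<Longrightarrow> \<exists>\<tau>. (\<sigma>, \<tau>) \<in> run (C as r k) \<and> \<tau> r = y"
  using assms(1)[unfolded realises_def, THEN spec, THEN spec, THEN spec, THEN mp, THEN mp, THEN mp, OF assms(2-4)]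
  by simp_all

text \<open>The arguments of \<open>f\<close> are computed one after another into the registers from
  \<open>k\<close> on. Both directions go by induction from the last argument backwards, the frame
  condition protecting the inputs and the values already found.\<close>

lemma realises_Comp:
  assumes f: "realises (compile f) (computes f)"
    and gs: "\<And>g. g \<in> set gs \<Longrightarrow> realises (compile g) (computes g)"
  shows "realises (compile (Comp f gs)) (computes (Comp f gs))"
proof -
  \<comment> \<open>\<open>args as k n\<close> is what remains to be done once the first
    \<open>n\<close> arguments have been computed.\<close>
  define args where "args = (\<lambda>as k n. seqs (map2 (\<lambda>C j. C as (k + j) (k + length gs)) (map compile (drop n gs)) [n..<length gs]))"
  have args_end: "args as k (length gs) = Skip" for as k
    by (simp add: args_def)
  have args_step: "args as k n = Seq (compile (gs ! n) as (k + n) (k + length gs)) (args as k (Suc n))"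
    if "n < length gs" for as k n
    unfolding args_def using that by (simp add: upt_conv_Cons flip: Cons_nth_drop_Suc)
  have sound: "(\<forall>i. n \<le> i \<longrightarrow> i < length gs \<longrightarrow> computes (gs ! i) (map \<sigma> as) (\<tau> (k + i))) \<and>
      (\<forall>q. q < k + n \<longrightarrow> \<tau> q = \<sigma> q)"
    if "n \<le> length gs" "(\<sigma>, \<tau>) \<in> run (args as k n)" "set as \<subseteq> {..<k}" for n as k \<sigma> \<tau>
    using that
  proof (induction n arbitrary: \<sigma> rule: inc_induct)
    case base
    then show ?case by (auto simp: args_end)
  next
    case (step n)
    then obtain \<rho> where \<rho>: "(\<sigma>, \<rho>) \<in> run (compile (gs ! n) as (k + n) (k + length gs))"
      "(\<rho>, \<tau>) \<in> run (args as k (Suc n))"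
      by (auto simp: args_step)
    have as: "set as \<subseteq> {..<k + length gs}" "k + n \<notin> set as" using step.prems by auto
    have r: "k + n < k + length gs" "realises (compile (gs ! n)) (computes (gs ! n))"
      using step.hyps gs by auto
    note g = realises_sound[OF r(2) as(1) r(1) as(2) \<rho>(1)] realises_frame[OF r(2) as(1) r(1) as(2) \<rho>(1)]
    note IH = step.IH[OF \<rho>(2) step.prems(2)]
    have \<rho>\<sigma>: "\<rho> q = \<sigma> q" if "q < k + n" for q using g(2)[of q] step.hyps that by auto
    then have map: "map \<rho> as = map \<sigma> as" using step.prems by auto
    have "computes (gs ! i) (map \<sigma> as) (\<tau> (k + i))" if "n \<le> i" "i < length gs" for i
    proof (cases "i = n")
      case True
      then show ?thesis using g(1) IH step.hyps by simp
    qed (use IH that map in simp)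
    then show ?case using IH \<rho>\<sigma> by auto
  qed
  have complete: "\<exists>\<tau>. (\<sigma>, \<tau>) \<in> run (args as k n)"
    if "n \<le> length gs" "\<And>i. i < length gs \<Longrightarrow> \<exists>y. computes (gs ! i) (map \<sigma> as) y" "set as \<subseteq> {..<k}" for n as k \<sigma>
    using that
  proof (induction n arbitrary: \<sigma> rule: inc_induct)
    case base
    then show ?case by (auto simp: args_end)
  next
    case (step n)
    have as: "set as \<subseteq> {..<k + length gs}" "k + n \<notin> set as" using step.prems by auto
    have r: "k + n < k + length gs" "realises (compile (gs ! n)) (computes (gs ! n))"
      using step.hyps gs by auto
    obtain y where "computes (gs ! n) (map \<sigma> as) y" using step.prems(1) step.hyps(2) by blast
    then obtain \<rho> where \<rho>: "(\<sigma>, \<rho>) \<in> run (compile (gs ! n) as (k + n) (k + length gs))"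
      using realises_complete[OF r(2) as(1) r(1) as(2)] by blast
    have "map \<rho> as = map \<sigma> as"
      using realises_frame[OF r(2) as(1) r(1) as(2) \<rho>] step.prems by auto
    then have "\<exists>\<tau>. (\<rho>, \<tau>) \<in> run (args as k (Suc n))" using step.prems by (intro step.IH) metis+
    then obtain \<tau> where "(\<rho>, \<tau>) \<in> run (args as k (Suc n))" by blast
    then show ?case using \<rho> by (auto simp: args_step[OF step.hyps(2)])
  qed
  have comp: "compile (Comp f gs) as r k = Seq (args as k 0) (compile f [k..<k + length gs] r (k + length gs))" for as r k
    by (simp add: args_def)
  have vals: "map \<rho> [k..<k + length gs] ! i = \<rho> (k + i)" if "i < length gs" for i k and \<rho> :: store
    using that by simp
  show ?thesis
  proof (rule realisesI)
    fix as :: "nat list" and r k and \<sigma> \<tau> :: store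
    assume a: "set as \<subseteq> {..<k}" "r < k" "r \<notin> set as" "(\<sigma>, \<tau>) \<in> run (compile (Comp f gs) as r k)"
    then obtain \<rho> where \<rho>: "(\<sigma>, \<rho>) \<in> run (args as k 0)"
      "(\<rho>, \<tau>) \<in> run (compile f [k..<k + length gs] r (k + length gs))"
      by (auto simp: comp simp del: compile.simps)
    note s = sound[OF _ \<rho>(1) a(1)]
    have args: "set [k..<k + length gs] \<subseteq> {..<k + length gs}" "r < k + length gs" "r \<notin> set [k..<k + length gs]"
      using a by auto
    note t = realises_sound[OF f args \<rho>(2)] realises_frame[OF f args \<rho>(2)]
    have "computes (Comp f gs) (map \<sigma> as) (\<tau> r)"
      by (rule computes.comp[where ys = "map \<rho> [k..<k + length gs]"])
        (use s t a in \<open>auto simp: vals simp del: map_eq_conv nth_map\<close>)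
    then show "computes (Comp f gs) (map \<sigma> as) (\<tau> r) \<and> (\<forall>q<k. q \<noteq> r \<longrightarrow> \<tau> q = \<sigma> q)"
      using s t a by auto
  next
    fix as :: "nat list" and r k and \<sigma> :: store and y
    assume a: "set as \<subseteq> {..<k}" "r < k" "r \<notin> set as" "computes (Comp f gs) (map \<sigma> as) y"
    from a(4) obtain ys where ys: "length ys = length gs"
      "\<And>i. i < length gs \<Longrightarrow> computes (gs ! i) (map \<sigma> as) (ys ! i)" "computes f ys y"
      by (rule computes_elims(4)) (rule that; blast)
    obtain \<rho> where \<rho>: "(\<sigma>, \<rho>) \<in> run (args as k 0)" using complete[of 0 \<sigma> as k] ys a by blast
    \<comment> \<open>Uniqueness of values identifies what the run has found with the arguments
      \<open>ys\<close> of the derivation.\<close>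
    have "map \<rho> [k..<k + length gs] = ys"
      by (rule nth_equalityI) (use ys sound[OF _ \<rho> a(1)] computes_unique in \<open>auto simp: vals simp del: nth_map\<close>)
    moreover have args: "set [k..<k + length gs] \<subseteq> {..<k + length gs}" "r < k + length gs" "r \<notin> set [k..<k + length gs]"
      using a by auto
    ultimately obtain \<tau> where "(\<rho>, \<tau>) \<in> run (compile f [k..<k + length gs] r (k + length gs))" "\<tau> r = y"
      using realises_complete[OF f args, of \<rho> y] ys(3) by metis
    then show "\<exists>\<tau>. (\<sigma>, \<tau>) \<in> run (compile (Comp f gs) as r k) \<and> \<tau> r = y"
      using \<rho> by (auto simp: comp simp del: compile.simps)
  qed
qed

text \<open>Register \<open>k\<close> counts, \<open>k + 1\<close> holds the value of the recursion
  at the counter, and \<open>k + 2\<close> receives the value of the next step. The loop may be left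
  at any time, but the test of \<open>k\<close> against \<open>n\<close> retains only the runs that
  leave it at the right moment.\<close>

lemma realises_PrimRec:
  assumes f: "realises (compile f) (computes f)" and g: "realises (compile g) (computes g)"
  shows "realises (compile (PrimRec f g)) (computes (PrimRec f g))"
proof (rule realisesI)
  fix as :: "nat list" and r k and \<sigma> \<tau> :: store
  assume a: "set as \<subseteq> {..<k}" "r < k" "r \<notin> set as" "(\<sigma>, \<tau>) \<in> run (compile (PrimRec f g) as r k)"
  obtain n xs where as: "as = n # xs" using a(4) by (cases as) auto
  let ?body = "seqs [compile g (k # (k + 1) # xs) (k + 2) (k + 3), copy (k + 2) (k + 1), Prim (Inc k)]"
  obtain \<rho> \<rho>' where \<rho>: "(\<sigma>, \<rho>) \<in> run (compile f xs (k + 1) (k + 3))"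
    "(\<rho>(k := 0), \<rho>') \<in> (run ?body)\<^sup>*" "\<rho>' k = \<rho>' n" "\<tau> = \<rho>'(r := \<rho>' (k + 1))"
    using a by (auto simp: as)
  have xs0: "set xs \<subseteq> {..<k + 3}" "k + 1 < k + 3" "k + 1 \<notin> set xs" using a as by auto
  note sf = realises_sound[OF f xs0 \<rho>(1)] realises_frame[OF f xs0 \<rho>(1)]
  have inv: "computes (PrimRec f g) (\<rho>' k # map \<sigma> xs) (\<rho>' (k + 1)) \<and> (\<forall>q<k. \<rho>' q = \<sigma> q)"
    using \<rho>(2)
  proof (induction rule: rtrancl_induct)
    case base
    then show ?case using sf a as by (auto intro!: computes.prim_0)
  next
    case (step \<mu> \<mu>')
    then obtain \<nu> where \<nu>: "(\<mu>, \<nu>) \<in> run (compile g (k # (k + 1) # xs) (k + 2) (k + 3))"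
      "\<mu>' = (\<nu>(k + 1 := \<nu> (k + 2)))(k := Suc (\<nu> k))"
      by auto
    have xs: "set (k # (k + 1) # xs) \<subseteq> {..<k + 3}" "k + 2 < k + 3" "k + 2 \<notin> set (k # (k + 1) # xs)"
      using a as by auto
    note sg = realises_sound[OF g xs \<nu>(1)] realises_frame[OF g xs \<nu>(1)]
    have "map \<mu> xs = map \<sigma> xs" using step a as by auto
    with sg(1) have "computes g (\<mu> k # \<mu> (k + 1) # map \<sigma> xs) (\<nu> (k + 2))" by (simp del: map_eq_conv)
    then show ?case using step.IH sg(2) a \<nu>(2) by (auto intro!: computes.prim_Suc)
  qed
  then show "computes (PrimRec f g) (map \<sigma> as) (\<tau> r) \<and> (\<forall>q<k. q \<noteq> r \<longrightarrow> \<tau> q = \<sigma> q)"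
    using \<rho> a as by auto
next
  fix as :: "nat list" and r k and \<sigma> :: store and y
  assume a: "set as \<subseteq> {..<k}" "r < k" "r \<notin> set as" "computes (PrimRec f g) (map \<sigma> as) y"
  obtain n xs where as: "as = n # xs" using a(4) by (cases as) (auto elim: computes.cases)
  let ?body = "seqs [compile g (k # (k + 1) # xs) (k + 2) (k + 3), copy (k + 2) (k + 1), Prim (Inc k)]"
  have xs0: "set xs \<subseteq> {..<k + 3}" "k + 1 < k + 3" "k + 1 \<notin> set xs" using a as by auto
  have xs1: "set (k # (k + 1) # xs) \<subseteq> {..<k + 3}" "k + 2 < k + 3" "k + 2 \<notin> set (k # (k + 1) # xs)"
    using a as by auto
  have key: "\<exists>\<rho> \<rho>'. (\<sigma>, \<rho>) \<in> run (compile f xs (k + 1) (k + 3)) \<and> (\<rho>(k := 0), \<rho>') \<in> (run ?body)\<^sup>* \<and>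
      \<rho>' k = i \<and> \<rho>' (k + 1) = z \<and> (\<forall>q<k. \<rho>' q = \<sigma> q)"
    if "computes (PrimRec f g) (i # map \<sigma> xs) z" for i z
    using that
  proof (induction i arbitrary: z)
    case 0
    then have "computes f (map \<sigma> xs) z" by (rule computes_elims(5))
    then obtain \<rho> where \<rho>: "(\<sigma>, \<rho>) \<in> run (compile f xs (k + 1) (k + 3))" "\<rho> (k + 1) = z"
      using realises_complete[OF f xs0] by blast
    note fr = realises_frame[OF f xs0 \<rho>(1)]
    then show ?case
      using \<rho> fr by - (rule exI[of _ \<rho>], rule exI[of _ "\<rho>(k := 0)"], auto)
  next
    case (Suc i)
    from Suc.prems obtain z' where z': "computes (PrimRec f g) (i # map \<sigma> xs) z'"
      "computes g (i # z' # map \<sigma> xs) z" by (rule computes_elims(6))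
    from Suc.IH[OF z'(1)] obtain \<rho> \<rho>' where \<rho>: "(\<sigma>, \<rho>) \<in> run (compile f xs (k + 1) (k + 3))"
      "(\<rho>(k := 0), \<rho>') \<in> (run ?body)\<^sup>*" "\<rho>' k = i" "\<rho>' (k + 1) = z'" "\<forall>q<k. \<rho>' q = \<sigma> q" by blast
    have "map \<rho>' (k # (k + 1) # xs) = i # z' # map \<sigma> xs" using \<rho> a as by auto
    then obtain \<nu> where \<nu>: "(\<rho>', \<nu>) \<in> run (compile g (k # (k + 1) # xs) (k + 2) (k + 3))" "\<nu> (k + 2) = z"
      using realises_complete[OF g xs1, of \<rho>' z] z'(2) by metis
    note fr = realises_frame[OF g xs1 \<nu>(1)]
    have "(\<rho>', (\<nu>(k + 1 := \<nu> (k + 2)))(k := Suc (\<nu> k))) \<in> run ?body" using \<nu>(1) by auto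
    with \<rho>(2) have "(\<rho>(k := 0), (\<nu>(k + 1 := \<nu> (k + 2)))(k := Suc (\<nu> k))) \<in> (run ?body)\<^sup>*" by (rule rtrancl_into_rtrancl)
    moreover have "((\<nu>(k + 1 := \<nu> (k + 2)))(k := Suc (\<nu> k))) k = Suc i"
      "((\<nu>(k + 1 := \<nu> (k + 2)))(k := Suc (\<nu> k))) (k + 1) = z"
      "\<forall>q<k. ((\<nu>(k + 1 := \<nu> (k + 2)))(k := Suc (\<nu> k))) q = \<sigma> q"
      using \<rho>(3-5) \<nu>(2) fr by auto
    ultimately show ?case using \<rho>(1) by blast
  qed
  obtain \<rho> \<rho>' where \<rho>: "(\<sigma>, \<rho>) \<in> run (compile f xs (k + 1) (k + 3))" "(\<rho>(k := 0), \<rho>') \<in> (run ?body)\<^sup>*"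
      "\<rho>' k = \<sigma> n" "\<rho>' (k + 1) = y" "\<forall>q<k. \<rho>' q = \<sigma> q"
    using key[of "\<sigma> n" y] a as by auto
  have "(\<sigma>, \<rho>'(r := y)) \<in> run (compile (PrimRec f g) as r k)"
    using a \<rho> unfolding as
    by simp (rule exI[of _ \<rho>], simp, rule exI[of _ \<rho>'], simp)
  then show "\<exists>\<tau>. (\<sigma>, \<tau>) \<in> run (compile (PrimRec f g) as r k) \<and> \<tau> r = y" by fastforce
qed

text \<open>Register \<open>k\<close> holds the candidate. The loop passes a candidate only on
  finding a positive value there, and the run finishes only on finding the value 0; this is
  minimisation with all smaller values defined and positive.\<close>

lemma realises_Mini:
  assumes f: "realises (compile f) (computes f)"
  shows "realises (compile (Mini f)) (computes (Mini f))"
proof (rule realisesI)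
  fix as :: "nat list" and r k and \<sigma> \<tau> :: store
  assume a: "set as \<subseteq> {..<k}" "r < k" "r \<notin> set as" "(\<sigma>, \<tau>) \<in> run (compile (Mini f) as r k)"
  let ?body = "seqs [compile f (k # as) (k + 1) (k + 3), is_pos (k + 1) (k + 2), Prim (Inc k)]"
  obtain \<rho> \<rho>' where \<rho>: "(\<sigma>(k := 0), \<rho>) \<in> (run ?body)\<^sup>*" "(\<rho>, \<rho>') \<in> run (compile f (k # as) (k + 1) (k + 3))"
    "\<rho>' (k + 1) = 0" "\<tau> = \<rho>'(k + 2 := 0, r := \<rho>' k)"
    using a by (auto )
  have as: "set (k # as) \<subseteq> {..<k + 3}" "k + 1 < k + 3" "k + 1 \<notin> set (k # as)" using a by auto
  have inv: "(\<forall>i<\<rho> k. \<exists>y. computes f (i # map \<sigma> as) (Suc y)) \<and> (\<forall>q<k. \<rho> q = \<sigma> q)"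
    using \<rho>(1)
  proof (induction rule: rtrancl_induct)
    case (step \<mu> \<mu>')
    then obtain \<nu> where \<nu>: "(\<mu>, \<nu>) \<in> run (compile f (k # as) (k + 1) (k + 3))" "\<nu> (k + 1) > 0"
      "\<mu>' = (\<nu>(k + 2 := \<nu> (k + 1)))(k := Suc (\<nu> k))"
      by auto
    note s = realises_sound[OF f as \<nu>(1)] realises_frame[OF f as \<nu>(1)]
    have "map \<mu> as = map \<sigma> as" using step.IH a(1) by auto
    with s(1) have "computes f (\<mu> k # map \<sigma> as) (\<nu> (k + 1))" by (simp del: map_eq_conv)
    then have "\<exists>y. computes f (\<mu> k # map \<sigma> as) (Suc y)" using \<nu>(2) by (auto simp: gr0_conv_Suc)
    moreover have "\<mu>' k = Suc (\<mu> k)" "\<And>q. q < k \<Longrightarrow> \<mu>' q = \<sigma> q" using step.IH s(2) \<nu>(3) by auto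
    ultimately show ?case using step.IH by (metis less_antisym)
  qed simp
  note s = realises_sound[OF f as \<rho>(2)] realises_frame[OF f as \<rho>(2)]
  have "map \<rho> as = map \<sigma> as" using inv a(1) by auto
  then have "computes f (\<rho> k # map \<sigma> as) 0" using s(1) \<rho>(3) by (simp del: map_eq_conv)
  then have "computes (Mini f) (map \<sigma> as) (\<rho> k)" using inv by (intro computes.mini) blast+
  then show "computes (Mini f) (map \<sigma> as) (\<tau> r) \<and> (\<forall>q<k. q \<noteq> r \<longrightarrow> \<tau> q = \<sigma> q)"
    using \<rho>(4) a(2) s(2) inv by simp
next
  fix as :: "nat list" and r k and \<sigma> :: store and y
  assume a: "set as \<subseteq> {..<k}" "r < k" "r \<notin> set as" "computes (Mini f) (map \<sigma> as) y"
  let ?body = "seqs [compile f (k # as) (k + 1) (k + 3), is_pos (k + 1) (k + 2), Prim (Inc k)]"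
  have as: "set (k # as) \<subseteq> {..<k + 3}" "k + 1 < k + 3" "k + 1 \<notin> set (k # as)" using a by auto
  have c: "computes f (y # map \<sigma> as) 0" "\<And>i. i < y \<Longrightarrow> \<exists>z. computes f (i # map \<sigma> as) (Suc z)"
    using a(4) by (rule computes_elims(7); blast)+
  have key: "\<exists>\<rho>. (\<sigma>(k := 0), \<rho>) \<in> (run ?body)\<^sup>* \<and> \<rho> k = i \<and> (\<forall>q<k. \<rho> q = \<sigma> q)" if "i \<le> y" for i
    using that
  proof (induction i)
    case 0
    show ?case by (intro exI[of _ "\<sigma>(k := 0)"]) auto
  next
    case (Suc i)
    from Suc.IH[OF Suc_leD[OF Suc.prems]] obtain \<rho> where \<rho>: "(\<sigma>(k := 0), \<rho>) \<in> (run ?body)\<^sup>*" "\<rho> k = i" "\<forall>q<k. \<rho> q = \<sigma> q" by blast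
    obtain z where z: "computes f (i # map \<sigma> as) (Suc z)" using c(2) Suc.prems Suc_le_lessD by blast
    have "map \<rho> (k # as) = i # map \<sigma> as" using \<rho>(2,3) a by auto
    then obtain \<nu> where \<nu>: "(\<rho>, \<nu>) \<in> run (compile f (k # as) (k + 1) (k + 3))" "\<nu> (k + 1) = Suc z"
      using realises_complete[OF f as, of \<rho> "Suc z"] z by metis
    note fr = realises_frame[OF f as \<nu>(1)]
    have "(\<rho>, (\<nu>(k + 2 := \<nu> (k + 1)))(k := Suc (\<nu> k))) \<in> run ?body" using \<nu> by auto
    with \<rho>(1) have "(\<sigma>(k := 0), (\<nu>(k + 2 := \<nu> (k + 1)))(k := Suc (\<nu> k))) \<in> (run ?body)\<^sup>*" by (rule rtrancl_into_rtrancl)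
    moreover have "((\<nu>(k + 2 := \<nu> (k + 1)))(k := Suc (\<nu> k))) k = Suc i"
      "\<forall>q<k. ((\<nu>(k + 2 := \<nu> (k + 1)))(k := Suc (\<nu> k))) q = \<sigma> q"
      using \<rho>(2,3) fr by auto
    ultimately show ?case by blast
  qed
  obtain \<rho> where \<rho>: "(\<sigma>(k := 0), \<rho>) \<in> (run ?body)\<^sup>*" "\<rho> k = y" "\<forall>q<k. \<rho> q = \<sigma> q" using key by blast
  have "map \<rho> (k # as) = y # map \<sigma> as" using \<rho>(2,3) a by auto
  with c(1) have "computes f (map \<rho> (k # as)) 0" by metis
  then obtain \<nu> where \<nu>: "(\<rho>, \<nu>) \<in> run (compile f (k # as) (k + 1) (k + 3))" "\<nu> (k + 1) = 0"
    using realises_complete[OF f as] by blast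
  note fr = realises_frame[OF f as \<nu>(1)]
  have "(\<sigma>, \<nu>(k + 2 := 0, r := y)) \<in> run (compile (Mini f) as r k)"
    using a(2) \<rho>(1,2) \<nu> fr[of k] by simp (rule exI[of _ \<rho>], simp, rule exI[of _ \<nu>], simp)
  then show "\<exists>\<tau>. (\<sigma>, \<tau>) \<in> run (compile (Mini f) as r k) \<and> \<tau> r = y" by fastforce
qed

lemma realises_compile: "realises (compile f) (computes f)"
proof (induction f)
  case Zero
  show ?case by (rule realisesI) (auto intro: computes.zero elim: computes_elims)
next
  case Succ
  show ?case
  proof (rule realisesI)
    fix as :: "nat list" and r k and \<sigma> \<tau> :: store
    assume "r \<notin> set as" "(\<sigma>, \<tau>) \<in> run (compile Succ as r k)"
    then show "computes Succ (map \<sigma> as) (\<tau> r) \<and> (\<forall>q<k. q \<noteq> r \<longrightarrow> \<tau> q = \<sigma> q)"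
      by (auto intro: computes.succ split: list.splits)
  next
    fix as :: "nat list" and r k and \<sigma> :: store and y
    assume "r \<notin> set as" "computes Succ (map \<sigma> as) y"
    then show "\<exists>\<tau>. (\<sigma>, \<tau>) \<in> run (compile Succ as r k) \<and> \<tau> r = y"
      by (auto elim: computes.cases split: list.splits)
  qed
next
  case (Proj i)
  show ?case
  proof (rule realisesI)
    fix as :: "nat list" and r k and \<sigma> \<tau> :: store
    assume "r \<notin> set as" "(\<sigma>, \<tau>) \<in> run (compile (Proj i) as r k)"
    moreover have "i < length as \<Longrightarrow> computes (Proj i) (map \<sigma> as) (map \<sigma> as ! i)"
      by (rule computes.proj) simp
    ultimately show "computes (Proj i) (map \<sigma> as) (\<tau> r) \<and> (\<forall>q<k. q \<noteq> r \<longrightarrow> \<tau> q = \<sigma> q)"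
      by (cases "as ! i = r") (auto split: if_splits)
  next
    fix as :: "nat list" and r k and \<sigma> :: store and y
    assume a: "r \<notin> set as" "computes (Proj i) (map \<sigma> as) y"
    then have "i < length as" "y = \<sigma> (as ! i)" by (auto elim: computes.cases)
    moreover from this have "as ! i \<noteq> r" using a by auto
    ultimately show "\<exists>\<tau>. (\<sigma>, \<tau>) \<in> run (compile (Proj i) as r k) \<and> \<tau> r = y"
      by auto
  qed
qed (auto intro: realises_Comp realises_PrimRec realises_Mini simp del: compile.simps)


section \<open>The automata of a functional graph\<close>

text \<open>
  A parity potential on a functional graph: fix a representative of each component and add up the
  marks on the two paths from a vertex and from the representative to a common vertex.
\<close>

lemma parity_potential:
  fixes f :: "'v \<Rightarrow> 'v" and s :: "'v \<Rightarrow> bool"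
  assumes acyc: "\<And>v n. n > 0 \<Longrightarrow> (f ^^ n) v = v \<Longrightarrow> \<not> s v"
  shows "\<exists>x. \<forall>v. x v \<longleftrightarrow> (s v \<noteq> x (f v))"
proof -
  define cnt where "cnt v n = (\<Sum>i<n. of_bool (s ((f ^^ i) v)) :: nat)" for v n
  have add: "cnt v (m + n) = cnt v m + cnt ((f ^^ m) v) n" for v m n
  proof (induction n)
    case (Suc n)
    have "(f ^^ (m + n)) v = (f ^^ n) ((f ^^ m) v)" by (metis add.commute comp_apply funpow_add)
    with Suc show ?case by (simp add: cnt_def)
  qed (simp add: cnt_def)
  \<comment> \<open>If two points of a path coincide, the stretch between them is periodic, so all
    its vertices lie on cycles and carry no marks.\<close>
  have per: "cnt v n = cnt v m" if "(f ^^ m) v = (f ^^ n) v" "m \<le> n" for v m n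
  proof (cases "m = n")
    case False
    define u where "u = (f ^^ m) v"
    have u: "(f ^^ (n - m)) u = u"
      using that by (metis comp_apply funpow_add le_add_diff_inverse2 u_def)
    have "\<not> s ((f ^^ i) u)" for i
      using acyc[of "n - m" "(f ^^ i) u"] u False that(2) by (metis add.commute comp_apply funpow_add le_neq_implies_less zero_less_diff)
    then have "cnt u (n - m) = 0" by (simp add: cnt_def)
    then show ?thesis using add[of v m "n - m"] that(2) u_def by simp
  qed simp
  have per': "cnt v n = cnt v m" if "(f ^^ m) v = (f ^^ n) v" for v m n
    using per[of m v n] per[of n v m] that by (metis nle_le)
  \<comment> \<open>The parity does not depend on the meeting point: beyond it both paths run
    through the same vertices, up to turns round an unmarked cycle.\<close>
  have meet: "even (cnt v i + cnt w j) \<longleftrightarrow> even (cnt v i' + cnt w j')"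
    if e: "(f ^^ i) v = (f ^^ j) w" "(f ^^ i') v = (f ^^ j') w" and le: "i \<le> i'" for v w i j i' j'
  proof -
    define k where "k = i' - i"
    have i': "i' = i + k" using le by (simp add: k_def)
    have "(f ^^ (j + k)) w = (f ^^ j') w"
      using e unfolding i' by (metis add.commute comp_apply funpow_add)
    then have "cnt w j' = cnt w j + cnt ((f ^^ j) w) k" using per'[of "j + k" w j'] add by metis
    then show ?thesis unfolding i' add using e by simp argo
  qed
  define conn where "conn v w \<longleftrightarrow> (\<exists>i j. (f ^^ i) v = (f ^^ j) w)" for v w
  have conn_f: "conn (f v) w \<longleftrightarrow> conn v w" for v w
  proof
    assume "conn (f v) w"
    then show "conn v w" unfolding conn_def by (metis comp_apply funpow_Suc_right)
  next
    assume "conn v w"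
    then obtain i j where "(f ^^ i) v = (f ^^ j) w" unfolding conn_def by blast
    then have "(f ^^ i) (f v) = (f ^^ Suc j) w" by (metis funpow_swap1 comp_apply funpow.simps(2))
    then show "conn (f v) w" unfolding conn_def by blast
  qed
  define rep where "rep v = (SOME w. conn v w)" for v
  \<comment> \<open>\<open>conn v\<close> and \<open>conn (f v)\<close> are the same predicate,
    hence the choice returns the same representative.\<close>
  have rep_f: "rep (f v) = rep v" for v by (simp add: rep_def conn_f)
  have "conn v v" for v unfolding conn_def by blast
  then have rep: "conn v (rep v)" for v unfolding rep_def by (rule someI)
  define x where "x v \<longleftrightarrow> (\<exists>i j. (f ^^ i) v = (f ^^ j) (rep v) \<and> odd (cnt v i + cnt (rep v) j))" for v
  have x: "x v \<longleftrightarrow> odd (cnt v i + cnt (rep v) j)" if "(f ^^ i) v = (f ^^ j) (rep v)" for v i j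
    unfolding x_def using meet[OF that] meet[OF _ that] that by (metis nle_le)
  have "x v \<longleftrightarrow> (s v \<noteq> x (f v))" for v
  proof -
    obtain i j where ij: "(f ^^ i) (f v) = (f ^^ j) (rep v)"
      using rep[of "f v"] unfolding conn_def rep_f by blast
    then have "x (f v) \<longleftrightarrow> odd (cnt (f v) i + cnt (rep v) j)" using x[of i "f v" j] rep_f by simp
    moreover have "(f ^^ Suc i) v = (f ^^ j) (rep v)" using ij by (simp add: funpow_swap1)
    then have "x v \<longleftrightarrow> odd (cnt v (Suc i) + cnt (rep v) j)" by (rule x)
    moreover have "cnt v (Suc i) = of_bool (s v) + cnt (f v) i"
      using add[of v 1 i] by (simp add: cnt_def)
    ultimately show ?thesis by auto
  qed
  then show ?thesis by blast
qed

text \<open>\<open>None\<close> is added as an absorbing, unmarked vertex, which makes the map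
  total.\<close>

corollary partial_parity_potential:
  fixes f :: "'v \<Rightarrow> 'v option" and s :: "'v \<Rightarrow> bool"
  assumes acyc: "\<And>v n. n > 0 \<Longrightarrow> ((\<lambda>w. Option.bind w f) ^^ n) (Some v) = Some v \<Longrightarrow> \<not> s v"
  shows "\<exists>x. \<forall>v. x v \<longleftrightarrow> (s v \<noteq> (case f v of None \<Rightarrow> False | Some w \<Rightarrow> x w))"
proof -
  obtain y where y: "\<And>v. y v \<longleftrightarrow> (case_option False s v \<noteq> y (Option.bind v f))"
  proof -
    have "\<not> case_option False s v" if "n > 0" "((\<lambda>w. Option.bind w f) ^^ n) v = v" for v n
      using acyc that by (cases v) auto
    then show thesis
      using parity_potential[of "\<lambda>w. Option.bind w f" "case_option False s"] that by metis
  qed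
  \<comment> \<open>Adding the constant \<open>y None\<close> modulo 2 normalises the potential to 0
    at \<open>None\<close>, as the default case requires.\<close>
  define x where "x v \<longleftrightarrow> y (Some v) \<noteq> y None" for v
  have "x v \<longleftrightarrow> (s v \<noteq> (case f v of None \<Rightarrow> False | Some w \<Rightarrow> x w))" for v
    using y[of "Some v"] by (auto simp: x_def split: option.splits)
  then show ?thesis by blast
qed

section \<open>Measure-preserving translations and measurability of the iterates\<close>

lemma distr_PiM_coordinatewise:
  assumes M: "\<And>i. i \<in> I \<Longrightarrow> prob_space (M i)"
    and f: "\<And>i. i \<in> I \<Longrightarrow> f i \<in> M i \<rightarrow>\<^sub>M M i" "\<And>i. i \<in> I \<Longrightarrow> distr (M i) (M i) (f i) = M i"
  shows "(\<lambda>\<omega>. \<lambda>i\<in>I. f i (\<omega> i)) \<in> PiM I M \<rightarrow>\<^sub>M PiM I M"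
    and "distr (PiM I M) (PiM I M) (\<lambda>\<omega>. \<lambda>i\<in>I. f i (\<omega> i)) = PiM I M"
proof -
  let ?T = "\<lambda>\<omega>. \<lambda>i\<in>I. f i (\<omega> i)"
  show meas: "?T \<in> PiM I M \<rightarrow>\<^sub>M PiM I M"
    by (rule measurable_restrict) (rule measurable_compose[OF measurable_component_singleton[where M = M] f(1)])
  interpret P: prob_space "PiM I M" by (rule prob_space_PiM) (rule M)
  have "PiM I M = distr (PiM I M) (PiM I M) ?T"
  proof (rule measure_eqI_PiM_infinite)
    show "finite_measure (PiM I M)" by unfold_locales
    fix A J assume J: "finite J" "J \<subseteq> I" and A: "\<And>i. i \<in> J \<Longrightarrow> A i \<in> sets (M i)"
    let ?E = "\<lambda>A. prod_emb I M J (Pi\<^sub>E J A)"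
    let ?B = "\<lambda>i. f i -` A i \<inter> space (M i)"
    have B: "?B i \<in> sets (M i)" if "i \<in> J" for i
      using f(1) A J that by (meson measurable_sets subsetD)
    have "emeasure (distr (PiM I M) (PiM I M) ?T) (?E A) = emeasure (PiM I M) (?T -` ?E A \<inter> space (PiM I M))"
      using J A by (intro emeasure_distr meas sets_PiM_I) auto
    \<comment> \<open>The preimage of a cylinder is the cylinder over the preimages, so its measure
      factorises and each factor is preserved.\<close>
    also have "?T -` ?E A \<inter> space (PiM I M) = ?E ?B"
    proof -
      have "f i y \<in> space (M i)" if "i \<in> I" "y \<in> space (M i)" for i y
        using measurable_space[OF f(1)] that by auto
      moreover have "i \<in> I" if "i \<in> J" for i using J(2) that by auto
      ultimately show ?thesis by (auto simp: prod_emb_def space_PiM PiE_iff extensional_def)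
    qed
    also have "emeasure (PiM I M) \<dots> = (\<Prod>i\<in>J. emeasure (M i) (?B i))"
      using J B M by (intro emeasure_PiM_emb) auto
    also have "\<dots> = (\<Prod>i\<in>J. emeasure (M i) (A i))"
    proof (rule prod.cong)
      fix i assume i: "i \<in> J"
      then have "emeasure (distr (M i) (M i) (f i)) (A i) = emeasure (M i) (?B i)"
        using f(1) A J by (intro emeasure_distr) auto
      then show "emeasure (M i) (?B i) = emeasure (M i) (A i)" using f(2) i J by auto
    qed simp
    also have "\<dots> = emeasure (PiM I M) (?E A)"
      using J A M by (intro emeasure_PiM_emb[symmetric]) auto
    finally show "emeasure (PiM I M) (?E A) = emeasure (distr (PiM I M) (PiM I M) ?T) (?E A)" by (rule sym)
  qed simp_all
  then show "distr (PiM I M) (PiM I M) ?T = PiM I M" by simp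
qed

text \<open>A bijection preserves the cardinality of preimages. This is applied to the translation
  of the bits at a single cell.\<close>

lemma distr_uniform_count_measure_bij:
  assumes "bij_betw f A A" "finite A"
  shows "f \<in> uniform_count_measure A \<rightarrow>\<^sub>M uniform_count_measure A"
    and "distr (uniform_count_measure A) (uniform_count_measure A) f = uniform_count_measure A"
proof -
  show f: "f \<in> uniform_count_measure A \<rightarrow>\<^sub>M uniform_count_measure A"
    using assms by (auto simp: measurable_def space_uniform_count_measure sets_uniform_count_measure bij_betw_def)
  show "distr (uniform_count_measure A) (uniform_count_measure A) f = uniform_count_measure A"
  proof (rule measure_eqI)
    fix X assume "X \<in> sets (distr (uniform_count_measure A) (uniform_count_measure A) f)"
    then have X: "X \<subseteq> A" by (simp add: sets_uniform_count_measure)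
    have "bij_betw f (f -` X \<inter> A) X"
    proof -
      have "f ` (f -` X \<inter> A) = X \<inter> f ` A" by auto
      then show ?thesis using assms(1) X unfolding bij_betw_def by (auto intro: inj_on_subset)
    qed
    then have "card (f -` X \<inter> A) = card X" by (rule bij_betw_same_card)
    then show "emeasure (distr (uniform_count_measure A) (uniform_count_measure A) f) X = emeasure (uniform_count_measure A) X"
      using X assms(2) f
      by (subst emeasure_distr) (auto simp: sets_uniform_count_measure space_uniform_count_measure emeasure_uniform_count_measure)
  qed simp
qed

text \<open>Countability allows one entry to be added at a time, by distinguishing its value. This
  serves for the neighbourhood of a cell and for the bits shown along a cycle.\<close>

lemma measurable_list_map:
  fixes g :: "'v \<Rightarrow> 'a \<Rightarrow> 'b :: countable"
  assumes "\<And>v. v \<in> set vs \<Longrightarrow> g v \<in> M \<rightarrow>\<^sub>M count_space UNIV"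
  shows "(\<lambda>x. map (\<lambda>v. g v x) vs) \<in> M \<rightarrow>\<^sub>M count_space UNIV"
  using assms
proof (induction vs)
  case (Cons v vs)
  have "(\<lambda>x. (\<lambda>b y. b # map (\<lambda>v. g v y) vs) (g v x) x) \<in> M \<rightarrow>\<^sub>M count_space UNIV"
  proof (rule measurable_compose_countable[where g = "g v"])
    show "(\<lambda>x. b # map (\<lambda>v. g v x) vs) \<in> M \<rightarrow>\<^sub>M count_space UNIV" for b
      by (rule measurable_compose[OF Cons.IH]) (use Cons.prems in auto)
  qed (use Cons.prems in auto)
  then show ?case by simp
qed simp

lemma measurable_count_space_UNIV_iff:
  "f \<in> M \<rightarrow>\<^sub>M count_space S \<longleftrightarrow> f \<in> M \<rightarrow>\<^sub>M count_space UNIV \<and> f \<in> space M \<rightarrow> S"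
proof (intro iffI conjI)
  assume f: "f \<in> M \<rightarrow>\<^sub>M count_space S"
  then show "f \<in> space M \<rightarrow> S" by (auto dest: measurable_space)
  show "f \<in> M \<rightarrow>\<^sub>M count_space UNIV" by (rule measurable_compose[OF f]) simp
next
  assume "f \<in> M \<rightarrow>\<^sub>M count_space UNIV \<and> f \<in> space M \<rightarrow> S"
  then show "f \<in> M \<rightarrow>\<^sub>M count_space S" by (auto simp: measurable_def)
qed

lemma vadd_in_lattice: "z \<in> lattice_pts d \<Longrightarrow> v \<in> lattice_pts d \<Longrightarrow> vadd z v \<in> lattice_pts d"
  by (simp add: lattice_pts_def vadd_def)

lemma vadd_zero: "z \<in> lattice_pts d \<Longrightarrow> vadd z (replicate d 0) = z"
  by (auto simp: lattice_pts_def vadd_def intro: nth_equalityI)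

text \<open>A cell depends on finitely many countably valued coordinates. Measurability is what
  gives \<open>distr\<close> its meaning in \<open>stoch_map\<close>.\<close>

lemma measurable_iterate:
  fixes A :: "('q :: countable, 'r :: countable) sca"
  assumes A: "is_sca d A" and c: "c \<in> configs d A" and "t \<le> n"
  shows "(\<lambda>s. iterate d A t c s) \<in> PiM {1..n} (\<lambda>_. uniform_rand d A) \<rightarrow>\<^sub>M config_space d A"
    (is "_ \<in> ?\<Omega> \<rightarrow>\<^sub>M _")
  using \<open>t \<le> n\<close>
proof (induction t)
  case 0
  show ?case using c by (simp add: config_space_def configs_def space_PiM)
next
  case (Suc t)
  let ?q = "\<lambda>v s. iterate d A t c s v" and ?r = "\<lambda>v s. s (Suc t) v"
  have q: "?q z \<in> ?\<Omega> \<rightarrow>\<^sub>M count_space (states A)" if "z \<in> lattice_pts d" for z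
  proof (rule measurable_compose[where g = "\<lambda>\<omega>. \<omega> z"])
    show "(\<lambda>s. iterate d A t c s) \<in> ?\<Omega> \<rightarrow>\<^sub>M config_space d A" using Suc by simp
    show "(\<lambda>\<omega>. \<omega> z) \<in> config_space d A \<rightarrow>\<^sub>M count_space (states A)"
      unfolding config_space_def by (rule measurable_component_singleton) (rule that)
  qed
  have r: "?r z \<in> ?\<Omega> \<rightarrow>\<^sub>M count_space (rsyms A)" if "z \<in> lattice_pts d" for z
  proof -
    have "(\<lambda>s. s (Suc t)) \<in> ?\<Omega> \<rightarrow>\<^sub>M uniform_rand d A"
      using Suc.prems by (intro measurable_component_singleton) simp
    moreover have "(\<lambda>u. u z) \<in> uniform_rand d A \<rightarrow>\<^sub>M uniform_count_measure (rsyms A)"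
      unfolding uniform_rand_def by (rule measurable_component_singleton) (rule that)
    ultimately have "?r z \<in> ?\<Omega> \<rightarrow>\<^sub>M uniform_count_measure (rsyms A)" by (rule measurable_compose)
    then show ?thesis
      using measurable_cong_sets[OF refl sets_uniform_count_measure_count_space, of ?\<Omega> "rsyms A"] by blast
  qed
  show ?case unfolding iterate.simps global_def config_space_def
  proof (rule measurable_restrict)
    fix z assume z: "z \<in> lattice_pts d"
    let ?x = "\<lambda>s. map (\<lambda>v. ?q (vadd z v) s) (nbhd A)" and ?y = "\<lambda>s. map (\<lambda>v. ?r (vadd z v) s) (rnbhd A)"
    have nb: "vadd z v \<in> lattice_pts d" if "v \<in> set (nbhd A) \<union> set (rnbhd A)" for v
      using A z that by (auto simp: is_sca_def intro: vadd_in_lattice)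
    have x: "?x \<in> ?\<Omega> \<rightarrow>\<^sub>M count_space UNIV" and y: "?y \<in> ?\<Omega> \<rightarrow>\<^sub>M count_space UNIV"
      by (rule measurable_list_map, use q[OF nb] in \<open>simp add: measurable_count_space_UNIV_iff[of _ _ "states A"]\<close>,
          rule measurable_list_map, use r[OF nb] in \<open>simp add: measurable_count_space_UNIV_iff[of _ _ "rsyms A"]\<close>)
    have "(\<lambda>s. locfun A (?x s) (?y s)) \<in> ?\<Omega> \<rightarrow>\<^sub>M count_space UNIV"
      by (rule measurable_compose_countable[where f = "\<lambda>x s. locfun A x (?y s)" and g = ?x, OF _ x])
        (rule measurable_compose[OF y], simp)
    moreover have "locfun A (?x s) (?y s) \<in> states A" if "s \<in> space ?\<Omega>" for s
    proof -
      have "set (?x s) \<subseteq> states A" "set (?y s) \<subseteq> rsyms A"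
        using measurable_space[OF q[OF nb] that] measurable_space[OF r[OF nb] that] by (simp_all add: image_subset_iff)
      then show ?thesis using A by (simp add: is_sca_def)
    qed
    ultimately show "(\<lambda>s. locfun A (?x s) (?y s)) \<in> ?\<Omega> \<rightarrow>\<^sub>M count_space (states A)"
      using measurable_count_space_UNIV_iff[of "\<lambda>s. locfun A (?x s) (?y s)" ?\<Omega> "states A"] by blast
  qed
qed

datatype layer = Jump | Seek | Sweep | Back | Down

instance layer :: finite
proof
  have "UNIV = {Jump, Seek, Sweep, Back, Down}" using layer.exhaust by auto
  then show "finite (UNIV :: layer set)" by (metis finite.simps)
qed

type_synonym bits = "layer \<Rightarrow> bool"

datatype dir = Far | Here | West | East | North | South

definition dirs :: "dir list" where "dirs = [Far, Here, West, East, North, South]"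

primrec dir_index :: "dir \<Rightarrow> nat" where
  "dir_index Far = 0" | "dir_index Here = 1" | "dir_index West = 2"
| "dir_index East = 3" | "dir_index North = 4" | "dir_index South = 5"

definition offset :: "nat \<Rightarrow> nat \<Rightarrow> dir \<Rightarrow> int list" where
  "offset d m e = (case e of Far \<Rightarrow> [int m, 0] | Here \<Rightarrow> [0, 0] | West \<Rightarrow> [-1, 0] | East \<Rightarrow> [1, 0]
     | North \<Rightarrow> [0, 1] | South \<Rightarrow> [0, -1]) @ replicate (d - 2) 0"

text \<open>
  A labelled cell is \<open>Fresh\<close> at time 0, receives one random bit per layer at time 1 and shows the
  outcome at time 2. Cells which start in any other state are \<open>Dead\<close> at time 2, so that nothing
  can be read off from prescribed bits.
\<close>

datatype 'l cell = Fresh 'l | Coin 'l bits | Out bits | Dead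

primrec fresh_label :: "'l cell \<Rightarrow> 'l option" where
  "fresh_label (Fresh l) = Some l" | "fresh_label (Coin l b) = None"
| "fresh_label (Out b) = None" | "fresh_label Dead = None"

primrec coin_label :: "'l cell \<Rightarrow> 'l option" where
  "coin_label (Fresh l) = None" | "coin_label (Coin l b) = Some l"
| "coin_label (Out b) = None" | "coin_label Dead = None"

primrec bits_of :: "'l cell \<Rightarrow> bits" where
  "bits_of (Fresh l) = (\<lambda>_. False)" | "bits_of (Coin l b) = b"
| "bits_of (Out b) = b" | "bits_of Dead = (\<lambda>_. False)"

text \<open>A move depends on the labels in view and on the layer, never on bits, so the random
  choices do not affect the functional graph.\<close>

type_synonym 'l walk = "(dir \<Rightarrow> 'l option) \<Rightarrow> layer \<Rightarrow> (dir \<times> layer) option"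

text \<open>Here \<open>\<noteq>\<close> on truth values is addition modulo 2, and \<open>g\<close>
  switches on the flips on the layer \<open>Jump\<close>. A missing or unlabelled successor
  contributes 0.\<close>

definition cell_rule :: "'l walk \<Rightarrow> bool \<Rightarrow> (dir \<Rightarrow> 'l cell) \<Rightarrow> bits \<Rightarrow> 'l cell" where
  "cell_rule nx g w r = (case w Here of
       Fresh l \<Rightarrow> Coin l r
     | Coin l b \<Rightarrow> Out (\<lambda>y. b y \<noteq> ((case nx (\<lambda>e. coin_label (w e)) y of None \<Rightarrow> False
         | Some (e, y') \<Rightarrow> coin_label (w e) \<noteq> None \<and> bits_of (w e) y') \<noteq> (g \<and> y = Jump)))
     | _ \<Rightarrow> Dead)"

definition cells :: "'l set \<Rightarrow> 'l cell set" where
  "cells L = Fresh ` L \<union> case_prod Coin ` (L \<times> UNIV) \<union> range Out \<union> {Dead}"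

lemma in_cells:
  "q \<in> cells L \<longleftrightarrow> (case q of Fresh l \<Rightarrow> l \<in> L | Coin l b \<Rightarrow> l \<in> L | _ \<Rightarrow> True)"
  by (cases q) (auto simp: cells_def image_iff)

lemma even_sum_cong:
  fixes f h :: "nat \<Rightarrow> nat"
  shows "(\<And>i. i < n \<Longrightarrow> even (f i) \<longleftrightarrow> even (h i)) \<Longrightarrow> even (sum f {..<n}) \<longleftrightarrow> even (sum h {..<n})"
  by (induction n) auto

text \<open>\<open>m\<close> enters only the neighbourhood and \<open>g\<close> only the local
  function, and neither changes the set of states; the diagonal argument relies on this.\<close>

definition walk_ca :: "nat \<Rightarrow> 'l set \<Rightarrow> 'l walk \<Rightarrow> nat \<Rightarrow> bool \<Rightarrow> (nat, nat) sca" where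
  "walk_ca d L nx m g =
     \<lparr>states = to_nat_on (cells L) ` cells L, rsyms = range (to_nat_on (UNIV :: bits set)),
      nbhd = map (offset d m) dirs, rnbhd = [replicate d 0],
      locfun = (\<lambda>x y. to_nat_on (cells L) (cell_rule nx g
        (\<lambda>e. from_nat_into (cells L) (x ! dir_index e)) (from_nat_into UNIV (hd y))))\<rparr>"

section \<open>Two-step behaviour of the automata and comparison of their laws\<close>

locale walk =
  fixes d :: nat and L :: "'l set" and nx :: "'l walk" and m :: nat
  assumes d: "d \<ge> 2" and m: "m \<ge> 2" and L: "finite L"
begin

abbreviation "ca \<equiv> walk_ca d L nx m"
abbreviation "enc \<equiv> to_nat_on (cells L)"
abbreviation "dec \<equiv> from_nat_into (cells L)"
abbreviation "bits_dec \<equiv> (from_nat_into UNIV :: nat \<Rightarrow> bits)"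
abbreviation "bits_enc \<equiv> to_nat_on (UNIV :: bits set)"

definition move :: "dir \<Rightarrow> int list \<Rightarrow> int list" where
  "move e z = vadd z (offset d m e)"

definition lab :: "(int list \<Rightarrow> nat) \<Rightarrow> int list \<Rightarrow> 'l option" where
  "lab c z = fresh_label (dec (c z))"

definition succ :: "(int list \<Rightarrow> nat) \<Rightarrow> int list \<times> layer \<Rightarrow> (int list \<times> layer) option" where
  "succ c = (\<lambda>(z, y). if lab c z = None then None else
     map_option (\<lambda>(e, y'). (move e z, y')) (nx (\<lambda>e. lab c (move e z)) y))"

definition outcome :: "bool \<Rightarrow> (int list \<Rightarrow> nat) \<Rightarrow> (int list \<Rightarrow> nat) \<Rightarrow> int list \<Rightarrow> bits" where
  "outcome g c u z y \<longleftrightarrow> bits_dec (u z) y \<noteq> ((case succ c (z, y) of None \<Rightarrow> False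
     | Some (z', y') \<Rightarrow> lab c z' \<noteq> None \<and> bits_dec (u z') y') \<noteq> (g \<and> y = Jump))"

lemma finite_cells: "finite (cells L)"
  using L by (auto simp: cells_def)

lemma dec_enc [simp]: "q \<in> cells L \<Longrightarrow> dec (enc q) = q"
  using finite_cells by (simp add: countable_finite)

lemma bits_dec_enc [simp]: "bits_dec (bits_enc b) = b"
  by (simp add: countable_finite)

lemma offset_in_lattice: "offset d m e \<in> lattice_pts d"
  using d by (cases e) (auto simp: offset_def lattice_pts_def)

lemma move_in_lattice [intro]: "z \<in> lattice_pts d \<Longrightarrow> move e z \<in> lattice_pts d"
  unfolding move_def by (rule vadd_in_lattice[OF _ offset_in_lattice])

lemma succ_in_lattice: "succ c v = Some w \<Longrightarrow> fst v \<in> lattice_pts d \<Longrightarrow> fst w \<in> lattice_pts d"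
  by (cases v; cases w) (auto simp: succ_def split: if_splits)

lemma succ_lab: "succ c v = Some w \<Longrightarrow> lab c (fst v) \<noteq> None"
  by (cases v) (auto simp: succ_def split: if_splits)

lemma move_Here: "z \<in> lattice_pts d \<Longrightarrow> move Here z = z"
proof -
  have "offset d m Here = replicate d 0"
    using d by (auto simp: offset_def numeral_2_eq_2 simp flip: replicate_Suc)
  then show "z \<in> lattice_pts d \<Longrightarrow> move Here z = z" by (simp add: move_def vadd_zero)
qed

lemma cell_rule_in_cells:
  assumes "w Here \<in> cells L"
  shows "cell_rule nx g w r \<in> cells L"
  using assms by (cases "w Here") (simp_all add: cell_rule_def in_cells)

lemma is_cfca_ca: "is_cfca d (ca g)"
proof -
  \<comment> \<open>For \<open>m = 0\<close> and \<open>m = 1\<close> the vector \<open>Far\<close>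
    would coincide with \<open>Here\<close> and with \<open>East\<close>.\<close>
  have "distinct (map (offset d m) dirs)"
    using m by (auto simp: dirs_def offset_def)
  moreover have "dec (x ! 1) \<in> cells L" if "set x \<subseteq> enc ` cells L" "length x = length dirs" for x
  proof -
    have "x ! 1 \<in> set x" using that(2) by (intro nth_mem) (simp add: dirs_def)
    then show ?thesis using that(1) by auto
  qed
  ultimately show ?thesis
    using finite_cells offset_in_lattice
    by (auto simp: is_cfca_def is_sca_def walk_ca_def lattice_pts_def intro!: imageI cell_rule_in_cells)
qed

lemma configs_ca: "c \<in> configs d (ca g) \<Longrightarrow> z \<in> lattice_pts d \<Longrightarrow> \<exists>q\<in>cells L. c z = enc q"
  by (auto simp: configs_def walk_ca_def PiE_iff)

lemma global_ca:
  assumes "z \<in> lattice_pts d"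
  shows "global d (ca g) c u z = enc (cell_rule nx g (\<lambda>e. dec (c (move e z))) (bits_dec (u z)))"
proof -
  have "map (\<lambda>v. c (vadd z v)) (map (offset d m) dirs) ! dir_index e = c (move e z)" for e
    by (cases e) (simp_all add: dirs_def move_def)
  then show ?thesis
    using assms unfolding global_def by (simp add: walk_ca_def vadd_zero del: map_map)
qed

text \<open>The labelled cells at time 0 are exactly the coins at time 1, with the same labels, so
  the moves read off in the second step are those of the initial configuration. The outcome depends
  only on \<open>c\<close> and on the symbols drawn at time 1.\<close>

lemma iterate_2_ca:
  assumes c: "c \<in> configs d (ca g)" and z: "z \<in> lattice_pts d"
  shows "iterate d (ca g) 2 c s z = enc (if lab c z = None then Dead else Out (outcome g c (s 1) z))"
proof -
  define w where "w z = cell_rule nx g (\<lambda>e. dec (c (move e z))) (bits_dec (s 1 z))" for z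
  have w: "w z \<in> cells L" "global d (ca g) c (s 1) z = enc (w z)"
    "coin_label (w z) = lab c z" "lab c z \<noteq> None \<Longrightarrow> bits_of (w z) = bits_dec (s 1 z)"
    "lab c z = None \<Longrightarrow> (\<exists>b. w z = Out b) \<or> w z = Dead"
    if "z \<in> lattice_pts d" for z
  proof -
    have "dec (c z) \<in> cells L" using configs_ca[OF c that] by auto
    then show "w z \<in> cells L"
      unfolding w_def by (intro cell_rule_in_cells) (simp add: move_Here that)
    show "global d (ca g) c (s 1) z = enc (w z)" by (simp add: w_def global_ca that)
    show "coin_label (w z) = lab c z" "lab c z \<noteq> None \<Longrightarrow> bits_of (w z) = bits_dec (s 1 z)"
      "lab c z = None \<Longrightarrow> (\<exists>b. w z = Out b) \<or> w z = Dead"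
      by (cases "dec (c z)"; simp add: w_def cell_rule_def lab_def move_Here that)+
  qed
  have mv: "move e z \<in> lattice_pts d" for e using z by (rule move_in_lattice)
  have "iterate d (ca g) 2 c s z = global d (ca g) (global d (ca g) c (s 1)) (s 2) z"
    by (simp add: numeral_2_eq_2)
  also have "\<dots> = enc (cell_rule nx g (\<lambda>e. dec (global d (ca g) c (s 1) (move e z))) (bits_dec (s 2 z)))"
    by (rule global_ca[OF z])
  also have "\<dots> = enc (cell_rule nx g (\<lambda>e. w (move e z)) (bits_dec (s 2 z)))"
    by (simp only: w(2)[OF mv] dec_enc[OF w(1)[OF mv]])
  also have "cell_rule nx g (\<lambda>e. w (move e z)) (bits_dec (s 2 z)) =
    (if lab c z = None then Dead else Out (outcome g c (s 1) z))"
  proof (cases "lab c z")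
    case None
    then show ?thesis using w(5)[OF z] by (auto simp: cell_rule_def move_Here z)
  next
    case (Some l)
    then obtain b where b: "w z = Coin l b" using w(3)[OF z] by (cases "w z") auto
    then have "b = bits_dec (s 1 z)" using w(4)[OF z] Some by auto
    with Some b show ?thesis
      by (auto simp: cell_rule_def move_Here z succ_def outcome_def w(3,4) mv split: option.splits intro!: ext)
  qed
  finally show ?thesis .
qed


text \<open>Adding a parity potential of the flips to the bits drawn at time 1 carries the outcomes
  of one automaton to those of the other. As this translation preserves the uniform measure, the
  laws agree.\<close>

lemma same_stoch_mapI:
  assumes acyc: "\<And>c z n. c \<in> configs d (ca False) \<Longrightarrow> z \<in> lattice_pts d \<Longrightarrow> n > 0 \<Longrightarrow>
    ((\<lambda>v. Option.bind v (succ c)) ^^ n) (Some (z, Jump)) \<noteq> Some (z, Jump)"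
  shows "same_stoch_map d 2 (ca False) (ca True)"
  unfolding same_stoch_map_def
proof (intro conjI ballI)
  show "states (ca False) = states (ca True)" by (simp add: walk_ca_def)
next
  fix c assume c: "c \<in> configs d (ca False)"
  then have c': "c \<in> configs d (ca True)" by (simp add: configs_def walk_ca_def)
  \<comment> \<open>Flips count only at labelled lattice cells: the acyclicity hypothesis concerns
    the lattice, and the potential must vanish at an unlabelled cell, whose bits contribute nothing
    to its predecessors.\<close>
  define flip where "flip v \<longleftrightarrow> snd v = Jump \<and> fst v \<in> lattice_pts d \<and> lab c (fst v) \<noteq> None" for v
  have "\<exists>x. \<forall>v. x v \<longleftrightarrow> (flip v \<noteq> (case succ c v of None \<Rightarrow> False | Some w \<Rightarrow> x w))"
    using acyc[OF c] by (intro partial_parity_potential) (auto simp: flip_def)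
  then obtain x where x: "\<And>v. x v \<longleftrightarrow> (flip v \<noteq> (case succ c v of None \<Rightarrow> False | Some w \<Rightarrow> x w))"
    by blast
  have x_unlab: "lab c z = None \<Longrightarrow> \<not> x (z, y)" for z y
    using x[of "(z, y)"] by (simp add: flip_def succ_def)
  define \<pi> where "\<pi> z n = bits_enc (\<lambda>y. bits_dec n y \<noteq> x (z, y))" for z n
  let ?A = "rsyms (ca True)"
  let ?\<Omega> = "PiM {1..2} (\<lambda>_. uniform_rand d (ca True)) :: (nat \<Rightarrow> int list \<Rightarrow> nat) measure"
  define shift where "shift = (\<lambda>u. \<lambda>z\<in>lattice_pts d. \<pi> z (u z))"
  \<comment> \<open>Only the symbols of time 1 are translated.\<close>
  let ?T = "\<lambda>s. \<lambda>i\<in>{1..2::nat}. (if i = 1 then shift else id) (s i)"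
  have \<pi>: "bij_betw (\<pi> z) ?A ?A" for z
    \<comment> \<open>The translation is its own inverse.\<close>
    by (rule bij_betw_byWitness[where f' = "\<pi> z"]) (auto simp: \<pi>_def walk_ca_def)
  have fin: "finite ?A" "?A \<noteq> {}" by (auto simp: walk_ca_def)
  have U: "prob_space (uniform_count_measure ?A)" by (rule prob_space_uniform_count_measure[OF fin])
  then have R: "prob_space (uniform_rand d (ca True))" unfolding uniform_rand_def by (rule prob_space_PiM)
  note shift_meas = distr_PiM_coordinatewise[of "lattice_pts d" "\<lambda>_. uniform_count_measure ?A" \<pi>,
      OF U distr_uniform_count_measure_bij[OF \<pi> fin(1)], folded uniform_rand_def shift_def]
  have "?T \<in> ?\<Omega> \<rightarrow>\<^sub>M ?\<Omega> \<and> distr ?\<Omega> ?\<Omega> ?T = ?\<Omega>"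
    using shift_meas R by (intro conjI distr_PiM_coordinatewise) (auto simp: id_def distr_id)
  then have T: "?T \<in> ?\<Omega> \<rightarrow>\<^sub>M ?\<Omega>" "distr ?\<Omega> ?\<Omega> ?T = ?\<Omega>" by blast+
  have iter: "iterate d (ca True) 2 c (?T s) z = iterate d (ca False) 2 c s z" for s z
  proof (cases "z \<in> lattice_pts d")
    case True
    have bits: "bits_dec (?T s 1 z) y \<longleftrightarrow> bits_dec (s 1 z) y \<noteq> x (z, y)" if "z \<in> lattice_pts d" for z y
      using that by (simp add: \<pi>_def shift_def)
    have "outcome True c (?T s 1) z y = outcome False c (s 1) z y" if "lab c z \<noteq> None" for y
    proof (cases "succ c (z, y)")
      case None
      have "x (z, y) \<longleftrightarrow> y = Jump" using x[of "(z, y)"] None that True by (simp add: flip_def)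
      then show ?thesis unfolding outcome_def bits[OF True] None option.case by blast
    next
      case (Some v)
      obtain z' y' where v: "v = (z', y')" by (cases v)
      have "z' \<in> lattice_pts d" using succ_in_lattice[OF Some] True v by simp
      note bits' = bits[OF this, of y']
      have "x (z, y) \<longleftrightarrow> ((y = Jump) \<noteq> x (z', y'))"
        using x[of "(z, y)"] Some v that True by (simp add: flip_def)
      then show ?thesis
        unfolding outcome_def bits[OF True] Some v option.case prod.case bits' using x_unlab[of z' y'] by blast
    qed
    then have flip: "lab c z \<noteq> None \<Longrightarrow> outcome True c (?T s 1) z = outcome False c (s 1) z" by (rule ext)
    show ?thesis
      unfolding iterate_2_ca[OF c True] iterate_2_ca[OF c' True]
      by (rule arg_cong[where f = enc], rule if_cong) (rule refl, rule refl, rule arg_cong[where f = Out], rule flip)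
  next
    case False
    then show ?thesis by (simp add: numeral_2_eq_2 global_def)
  qed
  have meas: "(\<lambda>s. iterate d (ca True) 2 c s) \<in> ?\<Omega> \<rightarrow>\<^sub>M config_space d (ca True)"
    using is_cfca_ca c' by (intro measurable_iterate) (auto simp: is_cfca_def)
  have same: "uniform_rand d (ca False) = uniform_rand d (ca True)"
    "config_space d (ca False) = config_space d (ca True)"
    by (simp_all add: uniform_rand_def config_space_def walk_ca_def)
  have "stoch_map d (ca True) 2 c = distr (distr ?\<Omega> ?\<Omega> ?T) (config_space d (ca True)) (\<lambda>s. iterate d (ca True) 2 c s)"
    by (simp only: T(2) stoch_map_def)
  also have "\<dots> = distr ?\<Omega> (config_space d (ca True)) ((\<lambda>s. iterate d (ca True) 2 c s) \<circ> ?T)"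
    by (rule distr_distr[OF meas T(1)])
  also have "(\<lambda>s. iterate d (ca True) 2 c s) \<circ> ?T = (\<lambda>s. iterate d (ca False) 2 c s)"
    by (intro ext) (simp only: comp_apply iter)
  finally show "stoch_map d (ca False) 2 c = stoch_map d (ca True) 2 c"
    by (simp only: same stoch_map_def)
qed


text \<open>Along a cycle the bits cancel, so that the sum of the outcomes is the number of flips.\<close>

lemma not_same_stoch_mapI:
  assumes c: "c \<in> configs d (ca False)" and v: "\<And>i. i < n \<Longrightarrow> succ c (v i) = Some (v (Suc i))"
    "v n = v 0" "fst (v 0) \<in> lattice_pts d" and odd: "odd (card {i. i < n \<and> snd (v i) = Jump})"
  shows "\<not> same_stoch_map d 2 (ca False) (ca True)"
proof
  assume "same_stoch_map d 2 (ca False) (ca True)"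
  then have eq: "stoch_map d (ca False) 2 c = stoch_map d (ca True) 2 c"
    using c by (simp add: same_stoch_map_def)
  \<comment> \<open>\<open>par\<close> counts the ones shown along the cycle. Its parity is surely
    even for one automaton and surely odd for the other.\<close>
  define par where "par \<omega> = (\<Sum>i<n. of_bool (bits_of (dec (\<omega> (fst (v i)))) (snd (v i))) :: nat)" for \<omega>
  let ?E = "{\<omega> \<in> space (config_space d (ca False)). even (par \<omega>)}"
  have cg: "c \<in> configs d (ca g)" for g using c by (simp add: configs_def walk_ca_def)
  have vl: "fst (v i) \<in> lattice_pts d" if "i \<le> n" for i
    using that
  proof (induction i)
    case (Suc i)
    then show ?case using succ_in_lattice[OF v(1)[of i]] by simp
  qed (rule v(3))
  have lab: "lab c (fst (v i)) \<noteq> None" if "i < n" for i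
    using succ_lab[OF v(1)[OF that]] .
  have lab': "lab c (fst (v (Suc i))) \<noteq> None" if "i < n" for i
    using lab[of "Suc i"] lab[of 0] that v(2) by (cases "Suc i = n") auto
  have par: "even (par (iterate d (ca g) 2 c s)) \<longleftrightarrow> \<not> g" for g s
  proof -
    define b where "b i = (of_bool (bits_dec (s 1 (fst (v i))) (snd (v i))) :: nat)" for i
    have "bits_of (dec (iterate d (ca g) 2 c s (fst (v i)))) (snd (v i)) \<longleftrightarrow>
      (bits_dec (s 1 (fst (v i))) (snd (v i)) \<noteq> (bits_dec (s 1 (fst (v (Suc i)))) (snd (v (Suc i))) \<noteq> (g \<and> snd (v i) = Jump)))"
      if "i < n" for i
    proof -
      obtain z y z' y' where v': "v i = (z, y)" "v (Suc i) = (z', y')" by (cases "v i"; cases "v (Suc i)")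
      show ?thesis
        using vl[of i] lab[OF that] lab'[OF that] v(1)[OF that] that unfolding v'
        by (auto simp: iterate_2_ca[OF cg] in_cells outcome_def)
    qed
    then have "even (par (iterate d (ca g) 2 c s)) \<longleftrightarrow> even (\<Sum>i<n. b i + b (Suc i) + of_bool (g \<and> snd (v i) = Jump))"
      unfolding par_def by (intro even_sum_cong) (simp add: b_def)
    also have "(\<Sum>i<n. b i + b (Suc i) + of_bool (g \<and> snd (v i) = Jump)) =
      (\<Sum>i<n. b i) + (\<Sum>i<n. b (Suc i)) + (\<Sum>i<n. of_bool (g \<and> snd (v i) = Jump))"
      by (simp add: sum.distrib)
    \<comment> \<open>Since the walk is closed, the bits of the successors are the bits of the cycle
      again and cancel modulo 2.\<close>
    also have "(\<Sum>i<n. b (Suc i)) = (\<Sum>i<n. b i)"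
      using sum.lessThan_Suc_shift[of b n] sum.lessThan_Suc[of b n] v(2) by (simp add: b_def)
    also have "(\<Sum>i<n. of_bool (g \<and> snd (v i) = Jump)) = (if g then card {i. i < n \<and> snd (v i) = Jump} else 0)"
      by (simp add: of_bool_def sum.If_cases Int_def lessThan_def)
    finally show ?thesis using odd by simp
  qed
  let ?\<Omega> = "\<lambda>g. PiM {1..2} (\<lambda>_. uniform_rand d (ca g)) :: (nat \<Rightarrow> int list \<Rightarrow> nat) measure"
  have meas: "(\<lambda>s. iterate d (ca g) 2 c s) \<in> ?\<Omega> g \<rightarrow>\<^sub>M config_space d (ca g)" for g
    using is_cfca_ca cg by (intro measurable_iterate) (auto simp: is_cfca_def)
  have same: "config_space d (ca True) = config_space d (ca False)"
    by (simp_all add: config_space_def walk_ca_def)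
  \<comment> \<open>The event depends on the finitely many cells of the cycle; writing
    \<open>par\<close> as a function of a list of bits makes it measurable.\<close>
  have E: "?E \<in> sets (config_space d (ca g))" for g
  proof -
    have "(\<lambda>\<omega>. bits_of (dec (\<omega> (fst (v i)))) (snd (v i))) \<in> config_space d (ca False) \<rightarrow>\<^sub>M count_space UNIV" if "i < n" for i
      unfolding config_space_def
      by (rule measurable_compose[OF measurable_component_singleton]) (use vl that in auto)
    then have "(\<lambda>\<omega>. map (\<lambda>i. bits_of (dec (\<omega> (fst (v i)))) (snd (v i))) [0..<n]) \<in> config_space d (ca False) \<rightarrow>\<^sub>M count_space UNIV"
      by (intro measurable_list_map) simp
    then have "(\<lambda>\<omega>. sum_list (map of_bool (map (\<lambda>i. bits_of (dec (\<omega> (fst (v i)))) (snd (v i))) [0..<n])) :: nat)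
        \<in> config_space d (ca False) \<rightarrow>\<^sub>M count_space UNIV"
      by (rule measurable_compose) simp
    also have "(\<lambda>\<omega>. sum_list (map of_bool (map (\<lambda>i. bits_of (dec (\<omega> (fst (v i)))) (snd (v i))) [0..<n]))) = par"
      by (simp add: par_def fun_eq_iff interv_sum_list_conv_sum_set_nat atLeast0LessThan)
    finally have "par \<in> config_space d (ca False) \<rightarrow>\<^sub>M count_space UNIV" .
    then have "par -` {k. even k} \<inter> space (config_space d (ca False)) \<in> sets (config_space d (ca False))"
      by (rule measurable_sets) simp
    also have "par -` {k. even k} \<inter> space (config_space d (ca False)) = ?E" by auto
    finally show ?thesis using same by (cases g) auto
  qed
  have emeas: "emeasure (stoch_map d (ca g) 2 c) ?E = (if g then 0 else emeasure (?\<Omega> g) (space (?\<Omega> g)))" for g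
  proof -
    have "iterate d (ca g) 2 c s \<in> space (config_space d (ca False))" if "s \<in> space (?\<Omega> g)" for s
      using measurable_space[OF meas that] same by (cases g) auto
    then have "(\<lambda>s. iterate d (ca g) 2 c s) -` ?E \<inter> space (?\<Omega> g) = {s \<in> space (?\<Omega> g). \<not> g}"
      unfolding vimage_def mem_Collect_eq par by blast
    then show ?thesis unfolding stoch_map_def emeasure_distr[OF meas E] by (cases g) simp_all
  qed
  have "prob_space (?\<Omega> False)" unfolding uniform_rand_def
    by (intro prob_space_PiM prob_space_uniform_count_measure) (auto simp: walk_ca_def)
  then have "emeasure (?\<Omega> False) (space (?\<Omega> False)) = 1" by (rule prob_space.emeasure_space_1)
  then show False using emeas[of False] emeas[of True] eq by simp
qed

end


section \<open>Space-time diagrams\<close>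

abbreviation nop :: instr where "nop \<equiv> Eq 0 0"

text \<open>Each step becomes one row of a diagram, so its action is exposed; purely structural
  steps carry \<open>nop\<close>, a test that always succeeds. \<open>Skip\<close> has no step and
  marks the top row.\<close>

inductive stp :: "com \<Rightarrow> instr \<Rightarrow> com \<Rightarrow> bool" where
  stp_Prim: "stp (Prim i) i Skip"
| stp_Seq_Skip: "stp (Seq Skip c) nop c"
| stp_Seq: "stp c i c' \<Longrightarrow> stp (Seq c e) i (Seq c' e)"
| stp_Loop: "stp (Loop c) nop (Seq c (Loop c))"
| stp_Loop_exit: "stp (Loop c) nop Skip"

inductive_cases stp_Skip [elim!]: "stp Skip i c"

definition sstep :: "com \<times> store \<Rightarrow> com \<times> store \<Rightarrow> bool" where
  "sstep = (\<lambda>(c, \<sigma>) (c', \<sigma>'). \<exists>i. stp c i c' \<and> exec i \<sigma> = Some \<sigma>')"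

lemma stp_run: "stp c i c' \<Longrightarrow> exec i \<sigma> = Some \<rho> \<Longrightarrow> (\<rho>, \<tau>) \<in> run c' \<Longrightarrow> (\<sigma>, \<tau>) \<in> run c"
proof (induction arbitrary: \<tau> rule: stp.induct)
  case (stp_Loop c)
  then obtain \<mu> where "(\<sigma>, \<mu>) \<in> run c" "(\<mu>, \<tau>) \<in> (run c)\<^sup>*" by auto
  then show ?case by (simp add: converse_rtrancl_into_rtrancl)
qed auto

lemma ssteps_run: "sstep\<^sup>*\<^sup>* (c, \<sigma>) (Skip, \<tau>) \<Longrightarrow> (\<sigma>, \<tau>) \<in> run c"
  by (induction rule: converse_rtranclp_induct2) (auto simp: sstep_def intro: stp_run)

lemma ssteps_Seq: "sstep\<^sup>*\<^sup>* (c, \<sigma>) (c', \<tau>) \<Longrightarrow> sstep\<^sup>*\<^sup>* (Seq c e, \<sigma>) (Seq c' e, \<tau>)"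
proof (induction rule: rtranclp_induct2)
  case (step c1 \<sigma>1 c2 \<sigma>2)
  then have "sstep (Seq c1 e, \<sigma>1) (Seq c2 e, \<sigma>2)" by (auto simp: sstep_def intro: stp_Seq)
  with step.IH show ?case by (rule rtranclp.rtrancl_into_rtrancl)
qed simp

lemma sstep_nop: "stp c nop c' \<Longrightarrow> sstep (c, \<sigma>) (c', \<sigma>)"
  by (auto simp: sstep_def)

lemma ssteps_Seq_run:
  assumes "sstep\<^sup>*\<^sup>* (c, \<sigma>) (Skip, \<rho>)" "sstep\<^sup>*\<^sup>* (e, \<rho>) (e', \<tau>)"
  shows "sstep\<^sup>*\<^sup>* (Seq c e, \<sigma>) (e', \<tau>)"
  using ssteps_Seq[OF assms(1), of e] sstep_nop[OF stp_Seq_Skip, of e \<rho>] assms(2)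
  by (meson converse_rtranclp_into_rtranclp rtranclp_trans)

lemma run_ssteps: "(\<sigma>, \<tau>) \<in> run c \<Longrightarrow> sstep\<^sup>*\<^sup>* (c, \<sigma>) (Skip, \<tau>)"
proof (induction c arbitrary: \<sigma> \<tau>)
  case (Prim i)
  then have "sstep (Prim i, \<sigma>) (Skip, \<tau>)" by (auto simp: sstep_def intro: stp_Prim)
  then show ?case by (rule r_into_rtranclp)
next
  case (Seq c e)
  then obtain \<rho> where "(\<sigma>, \<rho>) \<in> run c" "(\<rho>, \<tau>) \<in> run e" by auto
  then show ?case using Seq.IH by (blast intro: ssteps_Seq_run)
next
  case (Loop c)
  then have "(\<sigma>, \<tau>) \<in> (run c)\<^sup>*" by simp
  then show ?case
  proof (induction rule: converse_rtrancl_induct)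
    case base
    show ?case by (rule r_into_rtranclp) (rule sstep_nop[OF stp_Loop_exit])
  next
    case (step \<sigma> \<rho>)
    have "sstep\<^sup>*\<^sup>* (Seq c (Loop c), \<sigma>) (Skip, \<tau>)"
      using Loop.IH[OF step(1)] step.IH by (rule ssteps_Seq_run)
    with sstep_nop[OF stp_Loop] show ?case by (rule converse_rtranclp_into_rtranclp)
  qed
qed simp

text \<open>An upper bound for the programs reachable by \<open>stp\<close>. Its finiteness allows
  programs to serve as control states in labels.\<close>

primrec residuals :: "com \<Rightarrow> com set" where
  "residuals Skip = {Skip}"
| "residuals (Prim i) = {Prim i, Skip}"
| "residuals (Seq c e) = (\<lambda>c'. Seq c' e) ` residuals c \<union> residuals e"
| "residuals (Loop c) = {Loop c, Skip} \<union> (\<lambda>c'. Seq c' (Loop c)) ` residuals c"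

primrec actions :: "com \<Rightarrow> instr set" where
  "actions Skip = {nop}"
| "actions (Prim i) = {nop, i}"
| "actions (Seq c e) = actions c \<union> actions e"
| "actions (Loop c) = actions c"

lemma finite_residuals: "finite (residuals c)" and finite_actions: "finite (actions c)"
  by (induction c) auto

lemma residuals_refl: "c \<in> residuals c"
  by (induction c) auto

lemma nop_in_actions: "nop \<in> actions c"
  by (induction c) auto

lemma stp_residuals: "c \<in> residuals p \<Longrightarrow> stp c i c' \<Longrightarrow> c' \<in> residuals p \<and> i \<in> actions p"
proof (induction p arbitrary: c i c')
  case (Seq p q)
  show ?case
  proof (cases "c \<in> residuals q")
    case True
    then show ?thesis using Seq.IH(2) Seq.prems by auto
  next
    case False
    then obtain c1 where c1: "c = Seq c1 q" "c1 \<in> residuals p" using Seq.prems by auto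
    from Seq.prems(2) show ?thesis unfolding c1(1)
      by (cases rule: stp.cases) (use Seq.IH(1)[OF c1(2)] residuals_refl nop_in_actions in auto)
  qed
next
  case (Loop p)
  consider "c = Loop p" | "c = Skip" | c1 where "c = Seq c1 (Loop p)" "c1 \<in> residuals p"
    using Loop.prems by auto
  then show ?case
  proof cases
    case 1
    from Loop.prems(2) show ?thesis unfolding 1
      by (cases rule: stp.cases) (use residuals_refl nop_in_actions in auto)
  next
    case 2
    then show ?thesis using Loop.prems by auto
  next
    case 3
    from Loop.prems(2) show ?thesis unfolding 3(1)
      by (cases rule: stp.cases) (use Loop.IH[OF 3(2)] nop_in_actions in auto)
  qed
qed (auto elim: stp.cases)

text \<open>
  A cell of a diagram carries the current program and action, which are constant along a row, the set
  of the registers whose value exceeds the column number (\<open>bars\<close>), and marks for the left end, for the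
  right end and for the bottom row.
\<close>

datatype label = Label (ctl: com) (act: instr) (bars: "nat set") (lf: bool) (rt: bool) (bt: bool)

text \<open>
  \<open>chk i W B B'\<close> relates the bars \<open>B\<close> of a cell and \<open>W\<close> of its western neighbour to the bars \<open>B'\<close> above
  the cell.
\<close>

primrec chk :: "instr \<Rightarrow> nat set \<Rightarrow> nat set \<Rightarrow> nat set \<Rightarrow> bool" where
  "chk (Zer r) W B B' \<longleftrightarrow> B' = B - {r}"
| "chk (Inc r) W B B' \<longleftrightarrow> B' = (B - {r}) \<union> (W \<inter> {r})"
| "chk (Eq r s) W B B' \<longleftrightarrow> B' = B \<and> (r \<in> B \<longleftrightarrow> s \<in> B)"

section \<open>Local verification of stores written in unary\<close>

definition unary :: "store \<Rightarrow> nat \<Rightarrow> nat set" where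
  "unary \<sigma> x = {r. x < \<sigma> r}"

text \<open>An increment shifts the bars of its register one column to the east; at column 0 the
  absent western neighbour counts as full, because a successor is positive.\<close>

lemma chk_exec:
  assumes "exec i \<sigma> = Some \<tau>"
  shows "chk i (if x = 0 then UNIV else unary \<sigma> (x - 1)) (unary \<sigma> x) (unary \<tau> x)"
  using assms by (cases i) (auto simp: unary_def split: if_splits)

text \<open>No register exceeds \<open>w\<close>, so the columns up to \<open>w\<close> determine
  the store, and agreeing bars mean equal values. An increment may still reach \<open>w + 1\<close>;
  the test at the right end of the next row excludes that.\<close>

lemma exec_chk:
  assumes chk: "\<And>x. x \<le> w \<Longrightarrow> chk i (if x = 0 then UNIV else unary \<sigma> (x - 1)) (unary \<sigma> x) (B x)"
    and w: "unary \<sigma> w = {}"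
  shows "\<exists>\<tau>. exec i \<sigma> = Some \<tau> \<and> (\<forall>x\<le>w. B x = unary \<tau> x)"
proof (cases i)
  case (Zer r)
  have "B x = unary (\<sigma>(r := 0)) x" if "x \<le> w" for x
    using chk[OF that] by (auto simp: Zer unary_def)
  then show ?thesis by (simp add: Zer)
next
  case (Inc r)
  have "B x = unary (\<sigma>(r := Suc (\<sigma> r))) x" if "x \<le> w" for x
    using chk[OF that] by (cases x) (auto simp: Inc unary_def)
  then show ?thesis by (simp add: Inc)
next
  case (Eq r s)
  have le: "\<sigma> q \<le> w" for q using w by (auto simp: unary_def leI)
  have iff: "x < \<sigma> r \<longleftrightarrow> x < \<sigma> s" if "x \<le> w" for x using chk[OF that] by (auto simp: Eq unary_def)
  have "\<sigma> r = \<sigma> s"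
    using iff[OF le[of r]] iff[OF le[of s]] by auto
  moreover have "B x = unary \<sigma> x" if "x \<le> w" for x using chk[OF that] by (auto simp: Eq)
  ultimately show ?thesis by (simp add: Eq)
qed

text \<open>The tests make a row uniform in control, action and bottom mark, and relate it to the
  row above. On the bottom row the last clause of the eastern test carries emptiness to the right
  end, past the cells inspected on the layer \<open>Seek\<close>.\<close>

definition sweep_ok :: "com \<Rightarrow> (dir \<Rightarrow> label option) \<Rightarrow> label \<Rightarrow> bool" where
  "sweep_ok P V l \<longleftrightarrow> (bt l \<longrightarrow> ctl l = P) \<and> (rt l \<longrightarrow> bars l = {}) \<and>
     (\<not> rt l \<longrightarrow> (\<exists>f. V East = Some f \<and> ctl f = ctl l \<and> act f = act l \<and> bt f = bt l \<and> \<not> lf f \<and>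
        (bt l \<and> bars l = {} \<longrightarrow> bars f = {}))) \<and>
     (ctl l \<noteq> Skip \<longrightarrow> (\<exists>f. V North = Some f \<and> \<not> bt f \<and> lf f = lf l \<and> rt f = rt l \<and>
        stp (ctl l) (act l) (ctl f) \<and>
        chk (act l) (if lf l then UNIV else case V West of Some g \<Rightarrow> bars g | None \<Rightarrow> {}) (bars l) (bars f)))"

text \<open>A lap jumps from a left end of a bottom row, seeks a left end to the west, sweeps each
  row eastwards and returns, climbing until the program has ended, and then descends to the bottom
  row. \<open>Seek\<close> reads the input in unary: from a cell without bars it moves west only
  onto bottom cells with bars \<open>{0}\<close>.\<close>

definition walker :: "com \<Rightarrow> label walk" where
  "walker P V y = (case V Here of None \<Rightarrow> None | Some l \<Rightarrow> (case y of
       Jump \<Rightarrow> (case V Far of None \<Rightarrow> None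
         | Some f \<Rightarrow> if lf l \<and> bt l \<and> bt f \<and> bars f = {} then Some (Far, Seek) else None)
     | Seek \<Rightarrow> if lf l then Some (Here, Sweep) else (case V West of None \<Rightarrow> None
         | Some f \<Rightarrow> if bt f \<and> bars f = {0} then Some (West, Seek) else None)
     | Sweep \<Rightarrow> if sweep_ok P V l then Some (if rt l then (Here, Back) else (East, Sweep)) else None
     | Back \<Rightarrow> Some (if \<not> lf l then (West, Back) else if ctl l = Skip then (Here, Down) else (North, Sweep))
     | Down \<Rightarrow> Some (if bt l then (Here, Jump) else (South, Down))))"

text \<open>In a run from \<open>start n\<close> only register 0 and registers that are incremented
  can be nonzero, which keeps the alphabet finite.\<close>

definition labels :: "com \<Rightarrow> label set" where
  "labels P = {Label k i B l r b | k i B l r b. k \<in> residuals P \<and> i \<in> actions P \<and>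
     B \<subseteq> {0} \<union> {q. Inc q \<in> actions P}}"

lemma finite_labels: "finite (labels P)"
proof -
  have "{q. Inc q \<in> actions P} = Inc -` actions P" by auto
  then have fin: "finite ({0} \<union> {q. Inc q \<in> actions P})"
    using finite_vimageI[OF finite_actions, of Inc P] by (simp add: inj_on_def)
  have "labels P \<subseteq> (\<lambda>(k, i, B, l, r, b). Label k i B l r b) `
      (residuals P \<times> actions P \<times> Pow ({0} \<union> {q. Inc q \<in> actions P}) \<times> UNIV \<times> UNIV \<times> UNIV)"
    by (auto simp: labels_def image_iff)
  then show ?thesis
    by (rule finite_subset) (intro finite_imageI finite_cartesian_product finite_residuals finite_actions finite_Pow_iff[THEN iffD2] fin; simp)
qed

definition start :: "nat \<Rightarrow> store" where
  "start n = (\<lambda>_. 0)(0 := n)"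


section \<open>From closed walks to accepting runs\<close>

locale machine =
  fixes d :: nat and P :: com and m :: nat
  assumes d: "d \<ge> 2" and m: "m \<ge> 2"

sublocale machine \<subseteq> walk d "labels P" "walker P" m
  using d m finite_labels by unfold_locales

lemma sweep_ok_bt: "sweep_ok P V l \<Longrightarrow> bt l \<Longrightarrow> ctl l = P"
  and sweep_ok_rt: "sweep_ok P V l \<Longrightarrow> rt l \<Longrightarrow> bars l = {}"
  unfolding sweep_ok_def by blast+

context machine
begin

text \<open>The first return to the layer \<^term>\<open>Jump\<close>, at the cell \<open>z\<close> after \<open>n\<close> steps.\<close>

inductive hit :: "(int list \<Rightarrow> nat) \<Rightarrow> int list \<times> layer \<Rightarrow> nat \<Rightarrow> int list \<Rightarrow> bool" for c where
  hit_Jump: "succ c v = Some (z, Jump) \<Longrightarrow> hit c v 1 z"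
| hit_step: "succ c v = Some w \<Longrightarrow> snd w \<noteq> Jump \<Longrightarrow> hit c w n z \<Longrightarrow> hit c v (Suc n) z"

lemma hit_cases:
  assumes "hit c v n z"
  obtains "succ c v = Some (z, Jump)"
  | w k where "succ c v = Some w" "snd w \<noteq> Jump" "n = Suc k" "hit c w k z"
  using assms by (cases rule: hit.cases) auto

text \<open>All intermediate vertices avoid \<open>Jump\<close>, so a first return from
  \<open>(z, Jump)\<close> to \<open>z\<close> is a cycle with a single flip.\<close>

lemma hit_path:
  "hit c v n z \<Longrightarrow> \<exists>p. p 0 = v \<and> p n = (z, Jump) \<and> (\<forall>i<n. succ c (p i) = Some (p (Suc i))) \<and>
     (\<forall>i. 0 < i \<and> i < n \<longrightarrow> snd (p i) \<noteq> Jump)"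
proof (induction rule: hit.induct)
  case (hit_Jump v z)
  then show ?case by (intro exI[of _ "\<lambda>i. if i = 0 then v else (z, Jump)"]) auto
next
  case (hit_step v w n z)
  then obtain p where p: "p 0 = w" "p n = (z, Jump)" "\<forall>i<n. succ c (p i) = Some (p (Suc i))"
    "\<forall>i. 0 < i \<and> i < n \<longrightarrow> snd (p i) \<noteq> Jump" by blast
  show ?case
  proof (intro exI[of _ "\<lambda>i. case i of 0 \<Rightarrow> v | Suc k \<Rightarrow> p k"] conjI allI impI)
    show "snd (case i of 0 \<Rightarrow> v | Suc k \<Rightarrow> p k) \<noteq> Jump" if "0 < i \<and> i < Suc n" for i
      using that p hit_step.hyps(2) by (cases i; cases "i - 1") auto
  qed (use p hit_step.hyps(1) in \<open>auto split: nat.splits\<close>)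
qed

text \<open>Cuts off the first lap. The bound \<open>k \<le> n\<close> makes the rest shorter, as
  the induction over laps needs.\<close>

lemma iterate_hit:
  "((\<lambda>v. Option.bind v (succ c)) ^^ Suc n) (Some v) = Some (z, Jump) \<Longrightarrow>
   \<exists>z' k l. k \<le> n \<and> hit c v l z' \<and> ((\<lambda>v. Option.bind v (succ c)) ^^ k) (Some (z', Jump)) = Some (z, Jump)"
proof (induction n arbitrary: v)
  case 0
  then have "hit c v 1 z" by (intro hit_Jump) simp
  then show ?case by - (rule exI[of _ z], rule exI[of _ 0], rule exI[of _ 1], simp)
next
  case (Suc n)
  have none: "((\<lambda>v. Option.bind v (succ c)) ^^ k) None = None" for k by (induction k) auto
  obtain w where w: "succ c v = Some w"
    using Suc.prems none[of "Suc n"] by (cases "succ c v") (auto simp: funpow_Suc_right simp del: funpow.simps)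
  with Suc.prems have F: "((\<lambda>v. Option.bind v (succ c)) ^^ Suc n) (Some w) = Some (z, Jump)"
    by (simp add: funpow_Suc_right del: funpow.simps)
  show ?case
  proof (cases "snd w = Jump")
    case True
    then show ?thesis using w F hit_Jump[of c v "fst w"] by (metis le_refl prod.collapse)
  next
    case False
    then show ?thesis using Suc.IH[OF F] hit_step[OF w] by (meson le_SucI)
  qed
qed

text \<open>All moves stay in a plane: the coordinates in \<open>r\<close> never change.\<close>

lemma offset_Cons:
  "length r = d - 2 \<Longrightarrow> move e (x # y # r) = (case e of Far \<Rightarrow> x + int m | West \<Rightarrow> x - 1 | East \<Rightarrow> x + 1 | _ \<Rightarrow> x) #
     (case e of North \<Rightarrow> y + 1 | South \<Rightarrow> y - 1 | _ \<Rightarrow> y) # r"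
proof -
  have "map2 (+) r (replicate (length r) (0::int)) = r" by (auto intro: nth_equalityI)
  then show "length r = d - 2 \<Longrightarrow> ?thesis"
    by (cases e) (simp_all add: move_def vadd_def offset_def)
qed

context
  fixes c :: "int list \<Rightarrow> nat" and r :: "int list"
  assumes r: "length r = d - 2"
begin

abbreviation "pt x y \<equiv> x # y # r"

abbreviation "lb x y \<equiv> lab c (pt x y)"

abbreviation "view x y \<equiv> (\<lambda>e. lab c (move e (pt x y)))"

lemmas move_pt [simp] = offset_Cons[OF r]

lemma succ_pt: "succ c (pt x y, l) = map_option (\<lambda>(e, y'). (move e (pt x y), y')) (walker P (view x y) l)"
  by (auto simp: succ_def walker_def)

text \<open>A first return is finite, so the search must stop, and it stops only at a left end;
  every cell entered on the way has passed the test.\<close>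

lemma hit_Seek:
  "hit c v n z \<Longrightarrow> v = (pt x y, Seek) \<Longrightarrow> \<exists>k n'. (\<exists>l. lb (x - int k) y = Some l \<and> lf l) \<and>
     (\<forall>j<k. (\<exists>l. lb (x - int j) y = Some l \<and> \<not> lf l) \<and> (\<exists>l. lb (x - int (Suc j)) y = Some l \<and> bt l \<and> bars l = {0})) \<and>
     hit c (pt (x - int k) y, Sweep) n' z"
proof (induction arbitrary: x rule: hit.induct)
  case (hit_Jump v z)
  then show ?case by (auto simp: succ_pt walker_def split: option.splits if_splits)
next
  case (hit_step v w n z)
  from hit_step.hyps(1) consider
      l where "lb x y = Some l" "lf l" "w = (pt x y, Sweep)"
    | l f where "lb x y = Some l" "\<not> lf l" "lb (x - 1) y = Some f" "bt f" "bars f = {0}" "w = (pt (x - 1) y, Seek)"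
    unfolding hit_step.prems succ_pt by (auto simp: walker_def split: option.splits if_splits)
  then show ?case
  proof cases
    case 1
    then show ?thesis using hit_step.hyps(3) by - (rule exI[of _ 0], rule exI[of _ n], auto)
  next
    case (2 l f)
    from hit_step.IH[OF 2(6)] obtain k n' where k: "\<exists>l. lb (x - 1 - int k) y = Some l \<and> lf l"
     "\<forall>j<k. (\<exists>l. lb (x - 1 - int j) y = Some l \<and> \<not> lf l) \<and> (\<exists>l. lb (x - 1 - int (Suc j)) y = Some l \<and> bt l \<and> bars l = {0})"
     "hit c (pt (x - 1 - int k) y, Sweep) n' z" by blast
    have e: "x - int (Suc j) = x - 1 - int j" for j by simp
    show ?thesis
    proof (rule exI[of _ "Suc k"], rule exI[of _ n'], intro conjI allI impI)
      fix j assume j: "j < Suc k"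
      show "\<exists>l. lb (x - int j) y = Some l \<and> \<not> lf l" using 2 j k(2)
        by (cases j) (auto simp only: e of_nat_0 diff_zero)
      show "\<exists>l. lb (x - int (Suc j)) y = Some l \<and> bt l \<and> bars l = {0}" using 2 j k(2)
        by (cases j) (auto simp only: e of_nat_0 diff_zero)
    qed (use k in \<open>simp_all only: e\<close>)
  qed
qed

text \<open>Finiteness forces the sweep to meet a right end. The bound \<open>n' < n\<close> drives
  the induction over the rows.\<close>

lemma hit_Sweep:
  "hit c v n z \<Longrightarrow> v = (pt x y, Sweep) \<Longrightarrow> \<exists>w n'. n' < n \<and>
     (\<forall>j\<le>w. \<exists>l. lb (x + int j) y = Some l \<and> sweep_ok P (view (x + int j) y) l \<and> (rt l \<longleftrightarrow> j = w)) \<and>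
     hit c (pt (x + int w) y, Back) n' z"
proof (induction arbitrary: x rule: hit.induct)
  case (hit_Jump v z)
  then show ?case by (auto simp: succ_pt walker_def split: option.splits if_splits)
next
  case (hit_step v w n z)
  from hit_step.hyps(1) obtain l where l: "lb x y = Some l" "sweep_ok P (view x y) l"
    "w = (if rt l then (pt x y, Back) else (pt (x + 1) y, Sweep))"
    unfolding hit_step.prems succ_pt by (auto simp: walker_def split: option.splits if_splits)
  show ?case
  proof (cases "rt l")
    case True
    then show ?thesis using l hit_step.hyps(3) by - (rule exI[of _ 0], rule exI[of _ n], auto)
  next
    case False
    then have "w = (pt (x + 1) y, Sweep)" using l by simp
    from hit_step.IH[OF this] obtain k n' where k: "n' < n"
     "\<forall>j\<le>k. \<exists>l. lb (x + 1 + int j) y = Some l \<and> sweep_ok P (view (x + 1 + int j) y) l \<and> (rt l \<longleftrightarrow> j = k)"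
     "hit c (pt (x + 1 + int k) y, Back) n' z" by blast
    have e: "x + int (Suc j) = x + 1 + int j" for j by simp
    show ?thesis
    proof (rule exI[of _ "Suc k"], rule exI[of _ n'], intro conjI allI impI)
      fix j assume j: "j \<le> Suc k"
      show "\<exists>l. lb (x + int j) y = Some l \<and> sweep_ok P (view (x + int j) y) l \<and> (rt l \<longleftrightarrow> j = Suc k)"
      proof (cases j)
        case 0
        then show ?thesis using l False by auto
      next
        case (Suc i)
        then have "\<exists>l. lb (x + 1 + int i) y = Some l \<and> sweep_ok P (view (x + 1 + int i) y) l \<and> (rt l \<longleftrightarrow> i = k)"
          using k(2) j by auto
        then show ?thesis unfolding Suc e by simp
      qed
    qed (use k in \<open>simp_all only: e less_SucI\<close>)
  qed
qed

lemma hit_Back: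
  "hit c v n z \<Longrightarrow> v = (pt x y, Back) \<Longrightarrow> \<exists>k n' l. n' < n \<and> lb (x - int k) y = Some l \<and> lf l \<and>
     (\<forall>j<k. \<exists>l. lb (x - int j) y = Some l \<and> \<not> lf l) \<and>
     hit c (if ctl l = Skip then (pt (x - int k) y, Down) else (pt (x - int k) (y + 1), Sweep)) n' z"
proof (induction arbitrary: x rule: hit.induct)
  case (hit_Jump v z)
  then show ?case by (auto simp: succ_pt walker_def split: option.splits if_splits)
next
  case (hit_step v w n z)
  from hit_step.hyps(1) obtain l where l: "lb x y = Some l"
    "w = (if \<not> lf l then (pt (x - 1) y, Back) else if ctl l = Skip then (pt x y, Down) else (pt x (y + 1), Sweep))"
    unfolding hit_step.prems succ_pt by (auto simp: walker_def split: option.splits if_splits)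
  show ?case
  proof (cases "lf l")
    case True
    then show ?thesis using l hit_step.hyps(3) by - (rule exI[of _ 0], rule exI[of _ n], rule exI[of _ l], auto)
  next
    case False
    then have "w = (pt (x - 1) y, Back)" using l by simp
    from hit_step.IH[OF this] obtain k n' l' where k: "n' < n" "lb (x - 1 - int k) y = Some l'" "lf l'"
     "\<forall>j<k. \<exists>l. lb (x - 1 - int j) y = Some l \<and> \<not> lf l"
     "hit c (if ctl l' = Skip then (pt (x - 1 - int k) y, Down) else (pt (x - 1 - int k) (y + 1), Sweep)) n' z" by blast
    have e: "x - int (Suc j) = x - 1 - int j" for j by simp
    show ?thesis
    proof (rule exI[of _ "Suc k"], rule exI[of _ n'], rule exI[of _ l'], intro conjI allI impI)
      fix j assume j: "j < Suc k"
      show "\<exists>l. lb (x - int j) y = Some l \<and> \<not> lf l" using l False j k(4)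
        by (cases j) (auto simp only: e of_nat_0 diff_zero)
    qed (use k in \<open>simp_all only: e less_SucI\<close>)
  qed
qed

text \<open>\<open>Down\<close> is the only layer that leads to \<open>Jump\<close>, and it does so
  at the first bottom cell met.\<close>

lemma hit_Down:
  "hit c v n z \<Longrightarrow> v = (pt x y, Down) \<Longrightarrow> \<exists>k. z = pt x (y - int k) \<and> (\<exists>l. lb x (y - int k) = Some l \<and> bt l) \<and>
     (\<forall>j<k. \<exists>l. lb x (y - int j) = Some l \<and> \<not> bt l)"
proof (induction arbitrary: y rule: hit.induct)
  case (hit_Jump v z)
  then show ?case by (intro exI[of _ "0::nat"]) (auto simp: succ_pt walker_def split: option.splits if_splits)
next
  case (hit_step v w n z)
  from hit_step.hyps(1,2) obtain l where l: "lb x y = Some l" "\<not> bt l" "w = (pt x (y - 1), Down)"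
    unfolding hit_step.prems succ_pt by (auto simp: walker_def split: option.splits if_splits)
  from hit_step.IH[OF l(3)] obtain k where k: "z = pt x (y - 1 - int k)" "\<exists>l. lb x (y - 1 - int k) = Some l \<and> bt l"
     "\<forall>j<k. \<exists>l. lb x (y - 1 - int j) = Some l \<and> \<not> bt l" by blast
  have e: "y - int (Suc j) = y - 1 - int j" for j by simp
  show ?case
  proof (intro exI[of _ "Suc k"] conjI allI impI)
    fix j assume j: "j < Suc k"
    show "\<exists>l. lb x (y - int j) = Some l \<and> \<not> bt l" using l j k(3)
      by (cases j) (auto simp only: e of_nat_0 diff_zero)
  qed (use k in \<open>simp_all only: e\<close>)
qed

lemma sweep_ok_East:
  assumes "sweep_ok P (view x y) l" "\<not> rt l"
  shows "\<exists>f. lb (x + 1) y = Some f \<and> ctl f = ctl l \<and> act f = act l \<and> bt f = bt l \<and> \<not> lf f \<and>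
    (bt l \<and> bars l = {} \<longrightarrow> bars f = {})"
  using assms by (simp add: sweep_ok_def)

lemma sweep_ok_North:
  assumes "sweep_ok P (view x y) l" "ctl l \<noteq> Skip"
  shows "\<exists>f. lb x (y + 1) = Some f \<and> \<not> bt f \<and> lf f = lf l \<and> rt f = rt l \<and> stp (ctl l) (act l) (ctl f) \<and>
    chk (act l) (if lf l then UNIV else case lb (x - 1) y of Some g \<Rightarrow> bars g | None \<Rightarrow> {}) (bars l) (bars f)"
  using assms unfolding sweep_ok_def by (simp only: move_pt dir.case simp_thms)

text \<open>Strong induction on the length of the remaining walk. If the current row encodes a
  reachable store, the sweep forces the next row, of the same width, to encode a successor store;
  once the control is \<open>Skip\<close>, the descent ends at row 0, the only bottom cell so far in
  the left column.\<close>

lemma hit_rows: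
  assumes "hit c (pt x (y + int t), Sweep) n z"
    and "\<And>t'. t' \<le> t \<Longrightarrow> \<exists>l. lb x (y + int t') = Some l \<and> (bt l \<longleftrightarrow> t' = 0)"
    and "\<And>j. j \<le> w \<Longrightarrow> \<exists>l. lb (x + int j) (y + int t) = Some l \<and> (lf l \<longleftrightarrow> j = 0) \<and> (rt l \<longleftrightarrow> j = w) \<and>
      bars l = unary \<sigma> j"
    and "lb x (y + int t) = Some l0" and "sstep\<^sup>*\<^sup>* (P, \<sigma>0) (ctl l0, \<sigma>)"
  shows "z = pt x y \<and> (\<exists>\<tau>. (\<sigma>0, \<tau>) \<in> run P)"
  using assms
proof (induction n arbitrary: t \<sigma> l0 rule: less_induct)
  case (less n)
  define Y where "Y = y + int t"
  define l where "l j = the (lb (x + int j) Y)" for j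
  have l0: "l 0 = l0" using less.prems(4) by (simp add: l_def Y_def)
  have row: "lb (x + int j) Y = Some (l j)" "lf (l j) \<longleftrightarrow> j = 0" "rt (l j) \<longleftrightarrow> j = w" "bars (l j) = unary \<sigma> j"
    if jw: "j \<le> w" for j
  proof -
    obtain f where f: "lb (x + int j) Y = Some f" "lf f \<longleftrightarrow> j = 0" "rt f \<longleftrightarrow> j = w" "bars f = unary \<sigma> j"
      using less.prems(3)[OF jw, folded Y_def] by (elim exE conjE) (rule that)
    then have "l j = f" by (simp only: l_def option.sel)
    with f show "lb (x + int j) Y = Some (l j)" "lf (l j) \<longleftrightarrow> j = 0" "rt (l j) \<longleftrightarrow> j = w" "bars (l j) = unary \<sigma> j"
      by simp_all
  qed
  obtain w' n' where sweep: "n' < n \<and>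
    (\<forall>j\<le>w'. \<exists>l. lb (x + int j) Y = Some l \<and> sweep_ok P (view (x + int j) Y) l \<and> (rt l \<longleftrightarrow> j = w')) \<and>
    hit c (pt (x + int w') Y, Back) n' z"
    using hit_Sweep[OF less.prems(1) refl, folded Y_def] by (elim exE) (rule that)
  note w' = sweep[THEN conjunct1] sweep[THEN conjunct2, THEN conjunct1, rule_format] sweep[THEN conjunct2, THEN conjunct2]
  \<comment> \<open>The sweep stops at the first right end, which by the invariant sits in column
    \<open>w\<close>.\<close>
  have w'w: "w' = w"
  proof (rule linorder_cases[of w' w])
    assume "w' < w"
    moreover from this have "rt (l w')" using w'(2)[of w'] row(1)[of w'] by simp
    ultimately show ?thesis using row(3)[of w'] by simp
  next
    assume "w < w'"
    moreover from this have "\<not> rt (l w)" using w'(2)[of w] row(1)[of w] by simp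
    ultimately show ?thesis using row(3)[of w] by simp
  qed
  have ok: "sweep_ok P (view (x + int j) Y) (l j)" if "j \<le> w" for j
    using w'(2)[of j] that row(1)[OF that] unfolding w'w by (simp del: move_pt)
  have const: "j \<le> w \<Longrightarrow> ctl (l j) = ctl l0 \<and> act (l j) = act l0" for j
  proof (induction j)
    case (Suc j)
    have "\<not> rt (l j)" using row(3)[of j] Suc.prems by simp
    from sweep_ok_East[OF ok[OF Suc_leD[OF Suc.prems]] this]
    obtain f where f: "lb (x + int j + 1) Y = Some f" "ctl f = ctl (l j)" "act f = act (l j)"
      by (elim exE conjE) (rule that)
    have "x + int j + 1 = x + int (Suc j)" by simp
    then have "f = l (Suc j)" using f(1) by (simp only: l_def option.sel)
    then show ?case using f Suc.IH Suc.prems by simp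
  qed (simp add: l0)
  have "rt (l w)" using row(3)[of w] by simp
  with ok[OF order_refl] have "bars (l w) = {}" by (rule sweep_ok_rt)
  then have empty: "unary \<sigma> w = {}" using row(4)[of w] by simp
  obtain k n'' l' where k: "n'' < n'" "lb (x + int w - int k) Y = Some l'" "lf l'"
    "\<forall>j<k. \<exists>l. lb (x + int w - int j) Y = Some l \<and> \<not> lf l"
    "hit c (if ctl l' = Skip then (pt (x + int w - int k) Y, Down) else (pt (x + int w - int k) (Y + 1), Sweep)) n'' z"
    using hit_Back[OF w'(3)[unfolded w'w] refl] by (elim exE conjE) (rule that)
  \<comment> \<open>The return cannot pass column 0, which carries the mark of the left end.\<close>
  have "k \<le> w"
  proof (rule ccontr)
    assume "\<not> k \<le> w"
    then show False using k(4)[rule_format, of w] row(1,2)[of 0] by auto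
  qed
  then have e: "x + int w - int k = x + int (w - k)" by simp
  have "l' = l (w - k)" "lf (l (w - k))" using k(2,3) row(1)[of "w - k"] unfolding e by auto
  then have wk: "w - k = 0" using row(2)[of "w - k"] by simp
  then have l': "l' = l0" using \<open>l' = l (w - k)\<close> l0 by simp
  have hit: "hit c (if ctl l0 = Skip then (pt x Y, Down) else (pt x (Y + 1), Sweep)) n'' z"
    using k(5) by (simp only: e wk l' of_nat_0 add_0_right)
  show ?case
  proof (cases "ctl l0 = Skip")
    case True
    with hit have "hit c (pt x Y, Down) n'' z" by simp
    from hit_Down[OF this refl] obtain k where k: "z = pt x (Y - int k)" "\<exists>l. lb x (Y - int k) = Some l \<and> bt l"
      "\<forall>j<k. \<exists>l. lb x (Y - int j) = Some l \<and> \<not> bt l" by (elim exE conjE) (rule that; blast)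
    have "k \<le> t"
    proof (rule ccontr)
      assume "\<not> k \<le> t"
      then show False using k(3)[rule_format, of t] less.prems(2)[of 0] by (auto simp: Y_def)
    qed
    then have "Y - int k = y + int (t - k)" by (simp add: Y_def)
    then have "t - k = 0" using k(2) less.prems(2)[of "t - k"] by auto
    then have "z = pt x y" using k(1) \<open>Y - int k = y + int (t - k)\<close> by simp
    moreover have "(\<sigma>0, \<sigma>) \<in> run P" using less.prems(5) unfolding True by (rule ssteps_run)
    ultimately show ?thesis by blast
  next
    case False
    define u where "u j = the (lb (x + int j) (Y + 1))" for j
    have u: "lb (x + int j) (Y + 1) = Some (u j) \<and> \<not> bt (u j) \<and> (lf (u j) \<longleftrightarrow> j = 0) \<and> (rt (u j) \<longleftrightarrow> j = w) \<and>
      stp (ctl l0) (act l0) (ctl (u j)) \<and>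
      chk (act l0) (if j = 0 then UNIV else unary \<sigma> (j - 1)) (unary \<sigma> j) (bars (u j))" if jw: "j \<le> w" for j
    proof -
      have "ctl (l j) \<noteq> Skip" using const[OF jw] False by simp
      from sweep_ok_North[OF ok[OF jw] this]
      obtain f where f: "lb (x + int j) (Y + 1) = Some f" "\<not> bt f" "lf f = lf (l j)" "rt f = rt (l j)"
        "stp (ctl (l j)) (act (l j)) (ctl f)"
        "chk (act (l j)) (if lf (l j) then UNIV else case lb (x + int j - 1) Y of Some g \<Rightarrow> bars g | None \<Rightarrow> {}) (bars (l j)) (bars f)"
        by (elim exE conjE) (rule that)
      have "u j = f" using f(1) by (simp only: u_def option.sel)
      moreover have "(if lf (l j) then UNIV else case lb (x + int j - 1) Y of Some g \<Rightarrow> bars g | None \<Rightarrow> {}) =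
        (if j = 0 then UNIV else unary \<sigma> (j - 1))"
      proof (cases j)
        case (Suc i)
        then have "x + int j - 1 = x + int i" "i \<le> w" using jw by simp_all
        then show ?thesis using row[of i] row(2)[OF jw] Suc by simp
      qed (use row(2)[OF jw] in simp)
      ultimately show ?thesis
        using f const[OF jw] row(2-4)[OF jw] by simp
    qed
    obtain \<tau> where \<tau>: "exec (act l0) \<sigma> = Some \<tau>" "\<And>j. j \<le> w \<Longrightarrow> bars (u j) = unary \<tau> j"
      using exec_chk[of w "act l0" \<sigma> "\<lambda>j. bars (u j)", OF _ empty] u by blast
    have Y1: "Y + 1 = y + int (Suc t)" by (simp add: Y_def)
    show ?thesis
    proof (rule less.IH[of n'' "Suc t" \<tau> "u 0"])
      show "n'' < n" using k(1) w'(1) by simp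
      show "hit c (pt x (y + int (Suc t)), Sweep) n'' z" using hit False Y1 by simp
      show "\<exists>l. lb x (y + int t') = Some l \<and> (bt l \<longleftrightarrow> t' = 0)" if "t' \<le> Suc t" for t'
        using less.prems(2)[of t'] u[of 0] that Y1 by (cases "t' = Suc t") auto
      show "\<exists>l. lb (x + int j) (y + int (Suc t)) = Some l \<and> (lf l \<longleftrightarrow> j = 0) \<and> (rt l \<longleftrightarrow> j = w) \<and> bars l = unary \<tau> j"
        if "j \<le> w" for j
        using u[OF that] \<tau>(2)[OF that] unfolding Y1 by auto
      show "lb x (y + int (Suc t)) = Some (u 0)" using u[of 0] unfolding Y1 by simp
      have "sstep (ctl l0, \<sigma>) (ctl (u 0), \<tau>)" using u[of 0] \<tau>(1) by (auto simp: sstep_def)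
      with less.prems(5) show "sstep\<^sup>*\<^sup>* (P, \<sigma>0) (ctl (u 0), \<tau>)" by (rule rtranclp.rtrancl_into_rtrancl)
    qed
  qed
qed

text \<open>
  No check prevents the walker from meeting another left end before the one it started from, but
  then the new starting point lies strictly to the right, so that a cycle has only laps with \<open>k = m\<close>.
\<close>

lemma hit_lap:
  assumes "hit c (pt x y, Jump) n z"
  shows "\<exists>k\<le>m. z = pt (x + int m - int k) y \<and> (\<exists>\<tau>. (start k, \<tau>) \<in> run P)"
  using assms
proof (cases rule: hit_cases)
  case 1
  then have False by (auto simp: succ_pt walker_def split: option.splits if_splits)
  then show ?thesis ..
next
  case (2 w n1)
  obtain l f where l: "lb x y = Some l" "lf l" "lb (x + int m) y = Some f" "bt f" "bars f = {}"
    "hit c (pt (x + int m) y, Seek) n1 z"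
    using 2(1,4) by (auto simp: succ_pt walker_def split: option.splits if_splits)
  from hit_Seek[OF l(6) refl] obtain k n2 where k: "\<exists>l. lb (x + int m - int k) y = Some l \<and> lf l"
     "\<forall>j<k. (\<exists>l. lb (x + int m - int j) y = Some l \<and> \<not> lf l) \<and>
        (\<exists>l. lb (x + int m - int (Suc j)) y = Some l \<and> bt l \<and> bars l = {0})"
     "hit c (pt (x + int m - int k) y, Sweep) n2 z" by (elim exE[where P = "\<lambda>k. \<exists>n. _ k n"] exE[where P = "\<lambda>n. _ \<and> _ \<and> _ n"] conjE) (rule that)
  \<comment> \<open>The starting cell is itself a left end and lies \<open>m\<close> cells west of
    the landing cell, so the search stops there at the latest.\<close>
  have km: "k \<le> m"
  proof (rule ccontr)
    assume "\<not> k \<le> m"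
    then have "\<exists>l. lb (x + int m - int m) y = Some l \<and> \<not> lf l" using k(2) by (metis not_le_imp_less)
    then show False using l(1,2) by simp
  qed
  define x0 where "x0 = x + int m - int k"
  \<comment> \<open>Column \<open>j\<close> counted from the left end is step \<open>k - j\<close>
    of the search, counted from the landing cell. The bars are \<open>{0}\<close> in the first
    \<open>k\<close> columns and empty in column \<open>k\<close>, which spells the store
    \<open>start k\<close>.\<close>
  have seg: "\<exists>l. lb (x0 + int j) y = Some l \<and> bt l \<and> bars l = unary (start k) j" if "j \<le> k" for j
  proof (cases "j = k")
    case True
    then have "x0 + int j = x + int m" "unary (start k) j = {}" by (auto simp: x0_def unary_def start_def)
    then show ?thesis using l(3-5) by simp
  next
    case False
    then have e: "x0 + int j = x + int m - int (Suc (k - 1 - j))" using that by (simp add: x0_def)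
    have "unary (start k) j = {0}" using that False by (auto simp: unary_def start_def split: if_splits)
    moreover have "k - 1 - j < k" using that False by simp
    ultimately show ?thesis using k(2) unfolding e by metis
  qed
  obtain w where w:
    "\<forall>j\<le>w. \<exists>l. lb (x0 + int j) y = Some l \<and> sweep_ok P (view (x0 + int j) y) l \<and> (rt l \<longleftrightarrow> j = w)"
    using hit_Sweep[OF k(3) refl, folded x0_def] by (elim exE conjE) (rule that)
  define g where "g j = the (lb (x0 + int j) y)" for j
  have g: "lb (x0 + int j) y = Some (g j)" "sweep_ok P (view (x0 + int j) y) (g j)" "rt (g j) \<longleftrightarrow> j = w"
    if "j \<le> w" for j
    using w[rule_format, OF that] by (auto simp: g_def)
  have segg: "bt (g j) \<and> bars (g j) = unary (start k) j" if jk: "j \<le> k" for j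
  proof -
    obtain f where f: "lb (x0 + int j) y = Some f" "bt f" "bars f = unary (start k) j"
      using seg[OF jk] by (elim exE conjE) (rule that)
    then have "g j = f" by (simp only: g_def option.sel)
    then show ?thesis using f by simp
  qed
  have "\<exists>l. lb x0 y = Some l \<and> lf l" using k(1) by (simp only: x0_def)
  then have g0: "lf (g 0)" "bt (g 0)" using segg[of 0] by (auto simp: g_def)
  have east: "bt (g (Suc j)) = bt (g j) \<and> \<not> lf (g (Suc j)) \<and> (bt (g j) \<and> bars (g j) = {} \<longrightarrow> bars (g (Suc j)) = {})"
    if jw: "j < w" for j
  proof -
    have "\<not> rt (g j)" using g(3)[of j] jw by simp
    from sweep_ok_East[OF g(2)[OF less_imp_le[OF jw]] this]
    obtain f where f: "lb (x0 + int j + 1) y = Some f" "bt f = bt (g j)" "\<not> lf f"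
      "bt (g j) \<and> bars (g j) = {} \<longrightarrow> bars f = {}"
      by (elim exE conjE) (rule that)
    have "x0 + int j + 1 = x0 + int (Suc j)" by simp
    then have "f = g (Suc j)" using f(1) by (simp only: g_def option.sel)
    then show ?thesis using f by blast
  qed
  have bt: "j \<le> w \<Longrightarrow> bt (g j)" for j
    by (induction j) (use g0 east in auto)
  \<comment> \<open>The right end has no bars, so it cannot lie left of column \<open>k\<close>,
    where register 0 still has one.\<close>
  have kw: "k \<le> w"
  proof (rule ccontr)
    assume kw: "\<not> k \<le> w"
    have "rt (g w)" using g(3)[of w] by simp
    with g(2)[OF order_refl] have "bars (g w) = {}" by (rule sweep_ok_rt)
    moreover have "bars (g w) = unary (start k) w" using segg[of w] kw by simp
    moreover have "0 \<in> unary (start k) w" using kw by (simp add: unary_def start_def)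
    ultimately show False by simp
  qed
  \<comment> \<open>The search has inspected only the columns up to \<open>k\<close>; beyond them
    the sweep carries emptiness eastwards.\<close>
  have bars: "j \<le> w \<Longrightarrow> bars (g j) = unary (start k) j" for j
  proof (induction j)
    case 0
    show ?case using segg[of 0] by simp
  next
    case (Suc j)
    show ?case
    proof (cases "Suc j \<le> k")
      case True
      then show ?thesis using segg[of "Suc j"] by simp
    next
      case False
      then have "unary (start k) j = {}" "unary (start k) (Suc j) = {}" by (auto simp: unary_def start_def)
      moreover have "bars (g j) = unary (start k) j" "bt (g j)" using Suc bt by simp_all
      ultimately show ?thesis using east[of j] Suc.prems by simp
    qed
  qed
  have "ctl (g 0) = P" by (rule sweep_ok_bt[OF g(2)[OF le0] g0(2)])
  have res: "z = pt x0 y \<and> (\<exists>\<tau>. (start k, \<tau>) \<in> run P)"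
  proof (rule hit_rows[of x0 y 0 n2 z w "start k" "g 0"])
    show "hit c (pt x0 (y + int 0), Sweep) n2 z" using k(3) by (simp add: x0_def)
    show "\<exists>l. lb x0 (y + int t') = Some l \<and> (bt l \<longleftrightarrow> t' = 0)" if "t' \<le> 0" for t'
      using that g(1)[of 0] g0 by simp
    show "\<exists>l. lb (x0 + int j) (y + int 0) = Some l \<and> (lf l \<longleftrightarrow> j = 0) \<and> (rt l \<longleftrightarrow> j = w) \<and> bars l = unary (start k) j"
      if "j \<le> w" for j
    proof -
      have "lf (g j) \<longleftrightarrow> j = 0" using g0(1) east[of "j - 1"] that by (cases j) simp_all
      then show ?thesis using g(1,3)[OF that] bars[OF that] by simp
    qed
    show "lb x0 (y + int 0) = Some (g 0)" using g(1)[of 0] by simp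
    show "sstep\<^sup>*\<^sup>* (P, start k) (ctl (g 0), start k)" using \<open>ctl (g 0) = P\<close> by simp
  qed
  show ?thesis by (rule exI[of _ k]) (use km res in \<open>simp only: x0_def simp_thms\<close>)
qed

end

text \<open>A lap whose search has length \<open>j \<le> m\<close> moves the starting point by
  \<open>m - j\<close> to the east. The first coordinate never decreases, so a walk that returns to
  it has \<open>j = m\<close> in its first lap.\<close>

lemma cycle_halts:
  assumes "z \<in> lattice_pts d" "((\<lambda>v. Option.bind v (succ c)) ^^ n) (Some (z, Jump)) = Some (z', Jump)"
  shows "hd z \<le> hd z' \<and> (n > 0 \<and> hd z = hd z' \<longrightarrow> (\<exists>\<tau>. (start m, \<tau>) \<in> run P))"
  using assms
proof (induction n arbitrary: z rule: less_induct)
  case (less n)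
  show ?case
  proof (cases n)
    case 0
    then show ?thesis using less.prems by simp
  next
    case (Suc n')
    obtain z1 k l where z1: "k \<le> n'" "hit c (z, Jump) l z1"
      "((\<lambda>v. Option.bind v (succ c)) ^^ k) (Some (z1, Jump)) = Some (z', Jump)"
      using iterate_hit[OF less.prems(2)[unfolded Suc]] by blast
    obtain x y r where z: "z = x # y # r" "length r = d - 2"
      using less.prems(1) d by (cases z; cases "tl z") (auto simp: lattice_pts_def)
    obtain j where j: "j \<le> m" "z1 = (x + int m - int j) # y # r" "\<exists>\<tau>. (start j, \<tau>) \<in> run P"
      using hit_lap[OF z(2) z1(2)[unfolded z(1)]] by blast
    have "z1 \<in> lattice_pts d" using less.prems(1) by (simp add: z j lattice_pts_def)
    moreover have "k < n" using z1(1) Suc by simp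
    ultimately have "hd z1 \<le> hd z'" using less.IH z1(3) by blast
    moreover have hd: "hd z = x" "hd z1 = x + int m - int j" by (simp_all add: z j)
    ultimately have le: "hd z \<le> hd z'" using j(1) by simp
    show ?thesis
    proof (intro conjI impI le)
      assume "n > 0 \<and> hd z = hd z'"
      then have "j = m" using \<open>hd z1 \<le> hd z'\<close> hd j(1) by simp
      then show "\<exists>\<tau>. (start m, \<tau>) \<in> run P" using j(3) by blast
    qed
  qed
qed

end


section \<open>From accepting runs to closed walks\<close>

lemma finite_run_trace:
  assumes "(\<sigma>, \<tau>) \<in> run P"
  obtains h k i s where "k 0 = P" "s 0 = \<sigma>" "k h = Skip"
    "\<And>t. t < h \<Longrightarrow> stp (k t) (i t) (k (Suc t)) \<and> exec (i t) (s t) = Some (s (Suc t))"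
    "\<And>t. t \<ge> h \<Longrightarrow> i t = nop"
proof -
  obtain h where "(sstep ^^ h) (P, \<sigma>) (Skip, \<tau>)"
    using run_ssteps[OF assms] by (auto dest: rtranclp_imp_relpowp)
  then obtain f where f: "f 0 = (P, \<sigma>)" "f h = (Skip, \<tau>)" "\<And>t. t < h \<Longrightarrow> sstep (f t) (f (Suc t))"
    by (auto simp: relpowp_fun_conv)
  \<comment> \<open>The value \<open>nop\<close> serves for the top row, whose program has
    ended.\<close>
  define i where "i t = (if t < h then SOME i. stp (fst (f t)) i (fst (f (Suc t))) \<and>
    exec i (snd (f t)) = Some (snd (f (Suc t))) else nop)" for t
  have "stp (fst (f t)) (i t) (fst (f (Suc t))) \<and> exec (i t) (snd (f t)) = Some (snd (f (Suc t)))" if "t < h" for t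
  proof -
    have "\<exists>i. stp (fst (f t)) i (fst (f (Suc t))) \<and> exec i (snd (f t)) = Some (snd (f (Suc t)))"
      using f(3)[OF that] by (auto simp: sstep_def split: prod.splits)
    then show ?thesis unfolding i_def using that by (simp only: if_True) (rule someI_ex)
  qed
  then show thesis using f by (intro that[of "fst \<circ> f" "snd \<circ> f" h i]) (auto simp: i_def)
qed

text \<open>Bounds the registers that can have bars, so that the diagram stays within
  \<open>labels P\<close>.\<close>

lemma exec_support:
  assumes "exec i \<sigma> = Some \<tau>" "\<tau> q \<noteq> 0"
  shows "\<sigma> q \<noteq> 0 \<or> i = Inc q"
  using assms by (cases i) (auto split: if_splits)

lemma exec_bounded:
  assumes "exec i \<sigma> = Some \<tau>" "\<And>q. \<sigma> q \<le> b"
  shows "\<tau> q \<le> Suc b"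
  using assms(1) assms(2)[of q] by (cases i) (auto split: if_splits)

context machine
begin

text \<open>The diagram of the run is drawn in a rectangle with a corner at the origin of the first
  two coordinates; the walker then makes a single lap from the origin back to it.\<close>

lemma halting_hit:
  assumes "(start m, \<tau>) \<in> run P"
  shows "\<exists>c\<in>configs d (ca False). \<exists>z\<in>lattice_pts d. \<exists>n. hit c (z, Jump) n z"
proof -
  obtain h k i s where tr: "k 0 = P" "s 0 = start m" "k h = Skip"
    "\<And>t. t < h \<Longrightarrow> stp (k t) (i t) (k (Suc t)) \<and> exec (i t) (s t) = Some (s (Suc t))"
    "\<And>t. t \<ge> h \<Longrightarrow> i t = nop"
    using finite_run_trace[OF assms] by metis
  have inv: "k t \<in> residuals P \<and> {q. s t q \<noteq> 0} \<subseteq> {0} \<union> {q. Inc q \<in> actions P} \<and> (\<forall>q. s t q \<le> m + t)"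
    if "t \<le> h" for t
    using that
  proof (induction t)
    case 0
    show ?case by (auto simp: tr(1,2) start_def residuals_refl split: if_splits)
  next
    case (Suc t)
    then have IH: "k t \<in> residuals P" "{q. s t q \<noteq> 0} \<subseteq> {0} \<union> {q. Inc q \<in> actions P}" "\<And>q. s t q \<le> m + t"
      by auto
    have t: "stp (k t) (i t) (k (Suc t))" "exec (i t) (s t) = Some (s (Suc t))" using tr(4)[of t] Suc.prems by auto
    have st: "k (Suc t) \<in> residuals P" "i t \<in> actions P" using stp_residuals[OF IH(1) t(1)] by auto
    have "q \<in> {0} \<union> {q. Inc q \<in> actions P}" if "s (Suc t) q \<noteq> 0" for q
      using exec_support[OF t(2) that] IH(2) st(2) by auto
    moreover have "s (Suc t) q \<le> m + Suc t" for q using exec_bounded[OF t(2) IH(3)] by simp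
    ultimately show ?case using st(1) by auto
  qed
  \<comment> \<open>Values grow by at most 1 per step, so this width leaves the right end empty
    throughout; it also includes the landing column \<open>m\<close>.\<close>
  define w where "w = m + h"
  have le_w: "s t q \<le> w" if "t \<le> h" for t q
  proof -
    have "s t q \<le> m + t" using inv[OF that] by blast
    then show ?thesis using that by (simp add: w_def)
  qed
  have acts: "i t \<in> actions P" if "t \<le> h" for t
    using inv[OF that] tr(4,5)[of t] stp_residuals[of "k t" P "i t" "k (Suc t)"] nop_in_actions[of P] by (cases "t < h") auto
  have not_Skip: "k t \<noteq> Skip" if "t < h" for t using tr(4)[OF that] by auto
  define cell where "cell x t = Label (k t) (i t) (unary (s t) x) (x = 0) (x = w) (t = 0)" for x t
  have cell: "cell x t \<in> labels P" if "t \<le> h" for x t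
  proof -
    have "unary (s t) x \<subseteq> {q. s t q \<noteq> 0}" by (auto simp: unary_def)
    then show ?thesis using inv[OF that] acts[OF that] by (auto simp: labels_def cell_def)
  qed
  define r where "r = replicate (d - 2) (0 :: int)"
  have r: "length r = d - 2" by (simp add: r_def)
  let ?pt = "\<lambda>x t. int x # int t # r"
  have pt: "?pt x t \<in> lattice_pts d" for x t using d r by (simp add: lattice_pts_def)
  define val where "val z = (if 0 \<le> z ! 0 \<and> z ! 0 \<le> int w \<and> 0 \<le> z ! 1 \<and> z ! 1 \<le> int h
    then Fresh (cell (nat (z ! 0)) (nat (z ! 1))) else Dead)" for z :: "int list"
  define c where "c = (\<lambda>z\<in>lattice_pts d. enc (val z))"
  have val: "val z \<in> cells (labels P)" for z
    using cell[of "nat (z ! 1)"] by (auto simp: val_def in_cells)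
  have c: "c \<in> configs d (ca False)"
    using val by (auto simp: configs_def walk_ca_def c_def)
  have lb: "lab c (?pt x t) = Some (cell x t)" if "x \<le> w" "t \<le> h" for x t
    using that pt val[of "?pt x t"] by (simp add: lab_def c_def) (simp add: val_def)
  \<comment> \<open>The lap is followed backwards, from the final descent to the initial
    jump.\<close>
  define hits where "hits v \<longleftrightarrow> (\<exists>n. hit c v n (?pt 0 0))" for v
  have hits: "hits v" if "succ c v = Some v'" "snd v' \<noteq> Jump" "hits v'" for v v'
    using hit_step[OF that(1,2)] that(3) unfolding hits_def by blast
  have down: "hits (?pt 0 t, Down)" if "t \<le> h" for t
    using that
  proof (induction t)
    case 0
    have "succ c (?pt 0 0, Down) = Some (?pt 0 0, Jump)"
      using lb[of 0 0] by (simp add: succ_pt[OF r] move_pt[OF r] walker_def cell_def)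
    then show ?case unfolding hits_def by (blast intro: hit_Jump)
  next
    case (Suc t)
    have "succ c (?pt 0 (Suc t), Down) = Some (?pt 0 t, Down)"
      using lb[of 0 "Suc t"] Suc.prems by (simp add: succ_pt[OF r] move_pt[OF r] walker_def cell_def)
    then show ?case by (rule hits) (use Suc in auto)
  qed
  have backw: "hits (?pt x t, Back)"
    if "x \<le> w" "t \<le> h" "hits (if t = h then (?pt 0 t, Down) else (?pt 0 (Suc t), Sweep))" for x t
    using that(1)
  proof (induction x)
    case 0
    have "succ c (?pt 0 t, Back) = Some (if t = h then (?pt 0 t, Down) else (?pt 0 (Suc t), Sweep))"
      using lb[of 0 t] that(2) tr(3) not_Skip[of t]
      by (cases "t = h") (simp_all add: succ_pt[OF r] move_pt[OF r] walker_def cell_def)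
    then show ?case by (rule hits) (use that(3) in auto)
  next
    case (Suc x)
    have "succ c (?pt (Suc x) t, Back) = Some (?pt x t, Back)"
      using lb[of "Suc x" t] that(2) Suc.prems by (simp add: succ_pt[OF r] move_pt[OF r] walker_def cell_def)
    then show ?case by (rule hits) (use Suc in auto)
  qed
  have ok: "sweep_ok P (\<lambda>e. lab c (move e (?pt x t))) (cell x t)" if "x \<le> w" "t \<le> h" for x t
    unfolding sweep_ok_def
  proof (intro conjI impI)
    show "bt (cell x t) \<Longrightarrow> ctl (cell x t) = P" by (simp add: cell_def tr(1))
    show "rt (cell x t) \<Longrightarrow> bars (cell x t) = {}" using le_w[OF that(2)] by (auto simp: cell_def unary_def not_less)
  next
    assume "\<not> rt (cell x t)"
    then have "x < w" using that(1) by (simp add: cell_def)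
    then have "lab c (?pt (Suc x) t) = Some (cell (Suc x) t)" by (intro lb) (use that(2) in auto)
    moreover have "move East (?pt x t) = ?pt (Suc x) t" by (simp add: move_pt[OF r])
    ultimately show "\<exists>f. lab c (move East (?pt x t)) = Some f \<and> ctl f = ctl (cell x t) \<and> act f = act (cell x t) \<and>
        bt f = bt (cell x t) \<and> \<not> lf f \<and> (bt (cell x t) \<and> bars (cell x t) = {} \<longrightarrow> bars f = {})"
      by (auto simp: cell_def unary_def dest: Suc_lessD)
  next
    assume "ctl (cell x t) \<noteq> Skip"
    then have t: "t < h" using that(2) tr(3) by (cases "t = h") (auto simp: cell_def)
    have "move North (?pt x t) = ?pt x (Suc t)" by (simp add: move_pt[OF r])
    moreover have "lab c (?pt x (Suc t)) = Some (cell x (Suc t))" by (intro lb) (use that(1) t in auto)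
    moreover have "(if lf (cell x t) then UNIV else case lab c (move West (?pt x t)) of Some g \<Rightarrow> bars g | None \<Rightarrow> {}) =
      (if x = 0 then UNIV else unary (s t) (x - 1))"
    proof (cases x)
      case (Suc x')
      then have "move West (?pt x t) = ?pt x' t" by (simp add: move_pt[OF r])
      then show ?thesis using lb[of x' t] Suc that by (simp add: cell_def)
    qed (simp add: cell_def)
    ultimately show "\<exists>f. lab c (move North (?pt x t)) = Some f \<and> \<not> bt f \<and> lf f = lf (cell x t) \<and> rt f = rt (cell x t) \<and>
      stp (ctl (cell x t)) (act (cell x t)) (ctl f) \<and>
      chk (act (cell x t)) (if lf (cell x t) then UNIV else case lab c (move West (?pt x t)) of Some g \<Rightarrow> bars g | None \<Rightarrow> {})
        (bars (cell x t)) (bars f)"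
      using tr(4)[OF t] chk_exec[of "i t" "s t" "s (Suc t)" x] by (simp add: cell_def)
  qed
  have sweep: "hits (?pt x t, Sweep)" if "x \<le> w" "t \<le> h" "hits (?pt w t, Back)" for x t
    using that(1)
  proof (induction x rule: inc_induct)
    case base
    have "succ c (?pt w t, Sweep) = Some (?pt w t, Back)"
      using lb[of w t] ok[of w t] that(2) unfolding succ_pt[OF r]
      by (simp add: walker_def move_pt[OF r, of Here]) (simp add: cell_def)
    then show ?case by (rule hits) (use that in auto)
  next
    case (step x)
    have "succ c (?pt x t, Sweep) = Some (?pt (Suc x) t, Sweep)"
      using lb[of x t] ok[of x t] that(2) step.hyps unfolding succ_pt[OF r]
      by (simp add: walker_def move_pt[OF r, of Here]) (simp add: cell_def move_pt[OF r])
    then show ?case by (rule hits) (use step in auto)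
  qed
  have rows: "hits (?pt 0 t, Sweep)" if "t \<le> h" for t
    using that
  proof (induction t rule: inc_induct)
    case base
    show ?case by (intro sweep backw) (use down in auto)
  next
    case (step t)
    show ?case by (intro sweep backw) (use step in auto)
  qed
  have seek: "hits (?pt x 0, Seek)" if "x \<le> m" for x
    using that
  proof (induction x)
    case 0
    have "succ c (?pt 0 0, Seek) = Some (?pt 0 0, Sweep)"
      using lb[of 0 0] by (simp add: succ_pt[OF r] move_pt[OF r] walker_def cell_def)
    then show ?case by (rule hits) (use rows[of 0] in auto)
  next
    case (Suc x)
    have "unary (start m) x = {0}" using Suc.prems by (auto simp: unary_def start_def split: if_splits)
    then have "succ c (?pt (Suc x) 0, Seek) = Some (?pt x 0, Seek)"
      using lb[of "Suc x" 0] lb[of x 0] Suc.prems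
      by (simp add: succ_pt[OF r] move_pt[OF r] walker_def cell_def w_def tr(2))
    then show ?case by (rule hits) (use Suc in auto)
  qed
  have "unary (start m) m = {}" by (auto simp: unary_def start_def)
  then have "succ c (?pt 0 0, Jump) = Some (?pt m 0, Seek)"
    using lb[of 0 0] lb[of m 0] by (simp add: succ_pt[OF r] move_pt[OF r] walker_def cell_def w_def tr(2))
  then have "hits (?pt 0 0, Jump)" by (rule hits) (use seek in auto)
  then show ?thesis using c pt unfolding hits_def by blast
qed

theorem same_stoch_map_iff:
  "same_stoch_map d 2 (ca False) (ca True) \<longleftrightarrow> \<not> (\<exists>\<tau>. (start m, \<tau>) \<in> run P)"
proof
  assume "\<not> (\<exists>\<tau>. (start m, \<tau>) \<in> run P)"
  then show "same_stoch_map d 2 (ca False) (ca True)"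
    using cycle_halts by (intro same_stoch_mapI) blast
next
  assume same: "same_stoch_map d 2 (ca False) (ca True)"
  show "\<not> (\<exists>\<tau>. (start m, \<tau>) \<in> run P)"
  proof
    assume "\<exists>\<tau>. (start m, \<tau>) \<in> run P"
    then obtain c z n where c: "c \<in> configs d (ca False)" "z \<in> lattice_pts d" "hit c (z, Jump) n z"
      using halting_hit by blast
    obtain p where p: "p 0 = (z, Jump)" "p n = (z, Jump)" "\<And>i. i < n \<Longrightarrow> succ c (p i) = Some (p (Suc i))"
      "\<And>i. 0 < i \<Longrightarrow> i < n \<Longrightarrow> snd (p i) \<noteq> Jump"
      using hit_path[OF c(3)] by blast
    \<comment> \<open>The end \<open>p n\<close> repeats \<open>p 0\<close> and is not counted,
      which leaves a single flip.\<close>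
    have "n > 0" using c(3) by (cases rule: hit.cases) auto
    then have "{i. i < n \<and> snd (p i) = Jump} = {0}" using p(1,4) by (auto intro: ccontr)
    then have "\<not> same_stoch_map d 2 (ca False) (ca True)"
      using p c by (intro not_same_stoch_mapI[where v = p and n = n]) auto
    then show False using same by blast
  qed
qed

end


section \<open>Diagonalisation\<close>

lemma computes_Comp1:
  assumes "computes g xs y" "computes f [y] z"
  shows "computes (Comp f [g]) xs z"
  by (rule computes.comp[where ys = "[y]"]) (use assms in auto)

lemma computes_Comp2:
  assumes "computes g xs y" "computes h xs y'" "computes f [y, y'] z"
  shows "computes (Comp f [g, h]) xs z"
proof (rule computes.comp[where ys = "[y, y']"])
  show "computes ([g, h] ! i) xs ([y, y'] ! i)" if "i < length [g, h]" for i
    using that assms by (cases i) auto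
qed (use assms in auto)

lemma computes_Proj: "i < length xs \<Longrightarrow> xs ! i = y \<Longrightarrow> computes (Proj i) xs y"
  using computes.proj by blast

definition add_recf :: recf where
  "add_recf = PrimRec (Proj 0) (Comp Succ [Proj 1])"

lemma computes_add: "computes add_recf [x, y] (x + y)"
  unfolding add_recf_def
proof (induction x)
  case 0
  have "computes (Proj 0) [y] y" by (rule computes_Proj) simp_all
  then show ?case by (simp add: computes.prim_0)
next
  case (Suc x)
  have "computes (Comp Succ [Proj 1]) [x, x + y, y] (Suc (x + y))"
    by (rule computes_Comp1[where y = "x + y"]) (simp_all add: computes_Proj computes.succ)
  then show ?case unfolding add_Suc by (rule computes.prim_Suc[OF Suc.IH])
qed

text \<open>\<open>prod_encode (x, y)\<close> is \<open>triangle (x + y) + x\<close>, so triangular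
  numbers and sums give the pairing function.\<close>

definition triangle_recf :: recf where
  "triangle_recf = PrimRec Zero (Comp add_recf [Proj 1, Comp Succ [Proj 0]])"

lemma computes_triangle: "computes triangle_recf [x] (triangle x)"
  unfolding triangle_recf_def
proof (induction x)
  case 0
  show ?case by (auto intro: computes.prim_0 computes.zero)
next
  case (Suc x)
  have "computes (Comp add_recf [Proj 1, Comp Succ [Proj 0]]) [x, triangle x] (triangle x + Suc x)"
    by (rule computes_Comp2[OF _ computes_Comp1[where y = x] computes_add])
      (simp_all add: computes_Proj computes.succ)
  then show ?case unfolding triangle_Suc by (rule computes.prim_Suc[OF Suc.IH])
qed

text \<open>The three arguments stand for the codes of a state set and of two rule tables.\<close>

definition computable3 :: "(nat list \<Rightarrow> nat) \<Rightarrow> bool" where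
  "computable3 f \<longleftrightarrow> (\<exists>e. \<forall>xs. length xs = 3 \<longrightarrow> computes e xs (f xs))"

lemma computable3_Proj: "i < 3 \<Longrightarrow> computable3 (\<lambda>xs. xs ! i)"
  unfolding computable3_def by (rule exI[of _ "Proj i"]) (simp add: computes_Proj)

lemma computable3_Suc: "computable3 f \<Longrightarrow> computable3 (\<lambda>xs. Suc (f xs))"
  unfolding computable3_def by (meson computes_Comp1 computes.succ)

lemma computable3_const: "computable3 (\<lambda>xs. n)"
proof (induction n)
  case 0
  show ?case unfolding computable3_def by (auto intro: computes.zero)
qed (rule computable3_Suc)

lemma computable3_add: "computable3 f \<Longrightarrow> computable3 g \<Longrightarrow> computable3 (\<lambda>xs. f xs + g xs)"
  unfolding computable3_def by (meson computes_Comp2 computes_add)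

lemma computable3_prod_encode:
  assumes "computable3 f" "computable3 g"
  shows "computable3 (\<lambda>xs. prod_encode (f xs, g xs))"
proof -
  have "computable3 (\<lambda>xs. triangle (f xs + g xs))"
    using computable3_add[OF assms] unfolding computable3_def by (meson computes_Comp1 computes_triangle)
  then show ?thesis unfolding prod_encode_def prod.case using assms(1) by (rule computable3_add)
qed

lemmas computable3_intros = computable3_Proj computable3_Suc computable3_const computable3_add computable3_prod_encode

section \<open>The self-referential instance\<close>

declare compile.simps [simp del]

definition acceptor :: "recf \<Rightarrow> recf \<Rightarrow> recf \<Rightarrow> com" where
  "acceptor p eN eH = seqs [guess 1, guess 2, guess 3, compile eN [1, 2, 3] 4 7, Prim (Eq 4 0),
     compile (Comp p [eH]) [1, 2, 3] 5 7, Prim (Zer 6), Prim (Inc 6), Prim (Eq 5 6)]"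

lemma acceptor_halts_iff:
  assumes N: "\<And>xs. length xs = 3 \<Longrightarrow> computes eN xs (N xs)" and H: "\<And>xs. length xs = 3 \<Longrightarrow> computes eH xs (H xs)"
  shows "(\<exists>\<tau>. (start n, \<tau>) \<in> run (acceptor p eN eH)) \<longleftrightarrow>
    (\<exists>xs. length xs = 3 \<and> n = N xs \<and> computes p [H xs] 1)"
proof
  assume "\<exists>\<tau>. (start n, \<tau>) \<in> run (acceptor p eN eH)"
  then obtain a b c \<rho> \<mu> where \<rho>: "((start n)(1 := a, 2 := b, 3 := c), \<rho>) \<in> run (compile eN [1, 2, 3] 4 7)" "\<rho> 4 = \<rho> 0"
    and \<mu>: "(\<rho>, \<mu>) \<in> run (compile (Comp p [eH]) [1, 2, 3] 5 7)" "\<mu> 5 = 1"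
    by (auto simp: acceptor_def)
  note c = realises_compile
  \<comment> \<open>Below register 7 the first computation changes only register 4, so the input and
    the triple survive.\<close>
  have f: "\<rho> q = ((start n)(1 := a, 2 := b, 3 := c)) q" if "q < 7" "q \<noteq> 4" for q
    using realises_frame[OF c _ _ _ \<rho>(1) that] by simp
  have "computes eN [a, b, c] (\<rho> 4)" using realises_sound[OF c _ _ _ \<rho>(1)] by simp
  then have "\<rho> 4 = N [a, b, c]" using computes_unique[OF N] by force
  then have "n = N [a, b, c]" using \<rho>(2) f[of 0] by (simp add: start_def)
  moreover have "computes (Comp p [eH]) [a, b, c] 1"
    using realises_sound[OF c _ _ _ \<mu>(1)] \<mu>(2) f by simp
  then obtain ys where ys: "length ys = 1" "computes eH [a, b, c] (ys ! 0)" "computes p ys 1"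
    by (rule computes_elims(4)) auto
  then have "ys ! 0 = H [a, b, c]" using computes_unique[OF H] by force
  then have "ys = [H [a, b, c]]" using ys(1) by (cases ys) auto
  ultimately show "\<exists>xs. length xs = 3 \<and> n = N xs \<and> computes p [H xs] 1"
    using ys(3) by (intro exI[of _ "[a, b, c]"]) auto
next
  assume "\<exists>xs. length xs = 3 \<and> n = N xs \<and> computes p [H xs] 1"
  then obtain a b c where x: "n = N [a, b, c]" "computes p [H [a, b, c]] 1"
    by (auto simp: numeral_3_eq_3 length_Suc_conv)
  note r = realises_compile
  let ?\<sigma> = "(start n)(1 := a, 2 := b, 3 := c)"
  have cN: "computes eN (map ?\<sigma> [1, 2, 3]) n" using N[of "[a, b, c]"] x by simp
  have "\<exists>\<rho>. (?\<sigma>, \<rho>) \<in> run (compile eN [1, 2, 3] 4 7) \<and> \<rho> 4 = n"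
    by (rule realises_complete[OF r _ _ _ cN]) simp_all
  then obtain \<rho> where \<rho>: "(?\<sigma>, \<rho>) \<in> run (compile eN [1, 2, 3] 4 7)" "\<rho> 4 = n" by blast
  have f: "\<rho> q = ?\<sigma> q" if "q < 7" "q \<noteq> 4" for q
    using realises_frame[OF r _ _ _ \<rho>(1) that] by simp
  have "computes (Comp p [eH]) [a, b, c] 1" by (rule computes_Comp1[OF H x(2)]) simp
  then have cH: "computes (Comp p [eH]) (map \<rho> [1, 2, 3]) 1" by (simp add: f)
  have "\<exists>\<mu>. (\<rho>, \<mu>) \<in> run (compile (Comp p [eH]) [1, 2, 3] 5 7) \<and> \<mu> 5 = 1"
    by (rule realises_complete[OF r _ _ _ cH]) simp_all
  then obtain \<mu> where \<mu>: "(\<rho>, \<mu>) \<in> run (compile (Comp p [eH]) [1, 2, 3] 5 7)" "\<mu> 5 = 1" by blast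
  have "(start n, \<mu>(6 := 1)) \<in> run (acceptor p eN eH)"
    unfolding acceptor_def seqs.simps in_run run_guess
    by (rule exI[of _ "(start n)(1 := a)"], rule conjI, blast,
        rule exI[of _ "(start n)(1 := a, 2 := b)"], rule conjI, blast,
        rule exI[of _ ?\<sigma>], rule conjI, blast,
        rule exI[of _ \<rho>], rule conjI, rule \<rho>(1),
        rule exI[of _ \<rho>], rule conjI, simp add: \<rho>(2) f start_def,
        rule exI[of _ \<mu>], rule conjI, rule \<mu>(1), simp add: \<mu>(2))
  then show "\<exists>\<tau>. (start n, \<tau>) \<in> run (acceptor p eN eH)" by blast
qed

text \<open>
  Only the offset \<^term>\<open>Far\<close> depends on \<open>m\<close>, so that the code of the automaton is obtained from
  \<open>m\<close> and from the codes of its state set and of its rule table by means of the pairing function.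
\<close>

lemma sca_code_walk_ca:
  obtains k1 k2 k3 k4 where "\<And>(L :: 'l set) nx m g. sca_code (walk_ca d L nx m g) =
    Suc (prod_encode (list_encode (sorted_list_of_set (states (walk_ca d L nx 0 g))),
    Suc (prod_encode (k1,
    Suc (prod_encode (Suc (prod_encode (Suc (prod_encode (m + m, k2)), k3)),
    Suc (prod_encode (k4,
    Suc (prod_encode (list_encode (rule_table (walk_ca d L nx 0 g)), 0))))))))))"
proof -
  have eqs: "rule_table (walk_ca d L nx m g) = rule_table (walk_ca d L nx 0 g)"
    "states (walk_ca d L nx m g) = states (walk_ca d L nx 0 g)"
    "rsyms (walk_ca d L nx m g) = range (to_nat_on (UNIV :: bits set))"
    "map vec_code (nbhd (walk_ca d L nx m g)) = vec_code (offset d m Far) # map (vec_code \<circ> offset d 0) (tl dirs)"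
    "rnbhd (walk_ca d L nx m g) = [replicate d 0]" for L :: "'l set" and nx m g
    by (simp_all add: rule_table_def walk_ca_def) (simp add: dirs_def offset_def)
  \<comment> \<open>\<open>int_encode\<close> sends a nonnegative integer to its double, whence
    \<open>m + m\<close>.\<close>
  have far: "vec_code (offset d m Far) = Suc (prod_encode (m + m, list_encode (map int_encode (0 # replicate (d - 2) 0))))" for m
    by (simp add: vec_code_def offset_def int_encode_def sum_encode_def mult_2)
  have "sca_code (walk_ca d L nx m g) =
    Suc (prod_encode (list_encode (sorted_list_of_set (states (walk_ca d L nx 0 g))),
    Suc (prod_encode (list_encode (sorted_list_of_set (range (to_nat_on (UNIV :: bits set)))),
    Suc (prod_encode (Suc (prod_encode (Suc (prod_encode (m + m, list_encode (map int_encode (0 # replicate (d - 2) 0)))),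
      list_encode (map (vec_code \<circ> offset d 0) (tl dirs)))),
    Suc (prod_encode (list_encode [vec_code (replicate d 0)],
    Suc (prod_encode (list_encode (rule_table (walk_ca d L nx 0 g)), 0))))))))))" for L :: "'l set" and nx m g
    unfolding sca_code_def eqs(1)[of L nx m g] eqs(2)[of L nx m g] eqs(3-5) list_encode.simps far list.map ..
  then show thesis by (rule that)
qed

theorem corollary5p8:
  fixes d :: nat
  assumes "d \<ge> 2"
  shows "\<not> decidable_problem
     (\<lambda>(F :: (nat, nat) sca, G :: (nat, nat) sca). prod_encode (sca_code F, sca_code G))
     {(F, G). is_cfca d F \<and> is_cfca d G}
     (\<lambda>(F, G). same_stoch_map d 2 F G)"
proof
  assume "decidable_problem
     (\<lambda>(F :: (nat, nat) sca, G :: (nat, nat) sca). prod_encode (sca_code F, sca_code G))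
     {(F, G). is_cfca d F \<and> is_cfca d G}
     (\<lambda>(F, G). same_stoch_map d 2 F G)"
  then obtain p where p: "\<forall>x\<in>{(F, G). is_cfca d F \<and> is_cfca d G}.
      computes p [(\<lambda>(F :: (nat, nat) sca, G :: (nat, nat) sca). prod_encode (sca_code F, sca_code G)) x]
        (if (\<lambda>(F, G). same_stoch_map d 2 F G) x then 1 else 0)"
    unfolding decidable_problem_def by (elim exE) (rule that)
  \<comment> \<open>These constants do not depend on the label set or on the walker, so they may be
    built into a program that itself determines both.\<close>
  obtain k1 k2 k3 k4 where code: "\<And>(L :: label set) nx m g. sca_code (walk_ca d L nx m g) =
    Suc (prod_encode (list_encode (sorted_list_of_set (states (walk_ca d L nx 0 g))),
    Suc (prod_encode (k1,
    Suc (prod_encode (Suc (prod_encode (Suc (prod_encode (m + m, k2)), k3)),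
    Suc (prod_encode (k4,
    Suc (prod_encode (list_encode (rule_table (walk_ca d L nx 0 g)), 0))))))))))"
    by (rule sca_code_walk_ca[of d]) (rule that)
  \<comment> \<open>The two successors guarantee \<open>m \<ge> 2\<close>, and pairing makes
    \<open>N\<close> injective on triples.\<close>
  define N :: "nat list \<Rightarrow> nat"
    where "N = (\<lambda>xs. Suc (Suc (prod_encode (xs ! 0, prod_encode (xs ! 1, xs ! 2)))))"
  \<comment> \<open>Rebuilds the code of an automaton with parameter \<open>N xs\<close> from a
    triple, taking the state set from index 0 and the rule table from index
    \<open>i\<close>.\<close>
  define C :: "nat \<Rightarrow> nat list \<Rightarrow> nat" where "C = (\<lambda>i xs. Suc (prod_encode (xs ! 0,
    Suc (prod_encode (k1,
    Suc (prod_encode (Suc (prod_encode (Suc (prod_encode (N xs + N xs, k2)), k3)),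
    Suc (prod_encode (k4,
    Suc (prod_encode (xs ! i, 0)))))))))))"
  define H where "H = (\<lambda>xs. prod_encode (C 1 xs, C 2 xs))"
  have "computable3 N" unfolding N_def by (intro computable3_intros) simp_all
  then obtain eN where eN: "\<And>xs. length xs = 3 \<Longrightarrow> computes eN xs (N xs)" unfolding computable3_def by blast
  have "computable3 H" unfolding H_def C_def by (intro computable3_intros \<open>computable3 N\<close>) simp_all
  then obtain eH where eH: "\<And>xs. length xs = 3 \<Longrightarrow> computes eH xs (H xs)" unfolding computable3_def by blast
  define P where "P = acceptor p eN eH"
  define ca where "ca = walk_ca d (labels P) (walker P)"
  \<comment> \<open>The parameter 0 stands in for \<open>m\<close>, on which the state set and the
    tables do not depend; this avoids circularity, as \<open>m\<close> is defined from
    \<open>xs\<close>.\<close>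
  define xs where "xs = [list_encode (sorted_list_of_set (states (ca 0 False))),
    list_encode (rule_table (ca 0 False)), list_encode (rule_table (ca 0 True))]"
  define m where "m = N xs"
  interpret machine d P m
    using assms by unfold_locales (simp_all add: m_def N_def)
  have st: "states (ca 0 True) = states (ca 0 False)" by (simp add: ca_def walk_ca_def)
  have "sca_code (ca m False) = C 1 xs" "sca_code (ca m True) = C 2 xs"
    unfolding ca_def code C_def m_def[symmetric] using st[unfolded ca_def] by (simp_all add: xs_def ca_def)
  then have H: "prod_encode (sca_code (ca m False), sca_code (ca m True)) = H xs" by (simp add: H_def)
  have accept: "(\<exists>\<tau>. (start m, \<tau>) \<in> run P) \<longleftrightarrow> computes p [H xs] 1"
  proof -
    have len: "length xs = 3" by (simp add: xs_def)
    \<comment> \<open>By injectivity, the only triple that can pass the test on input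
      \<open>m\<close> describes the program's own automata.\<close>
    have "ys = xs" if ys: "length ys = 3" "m = N ys" for ys
    proof (rule nth_equalityI)
      fix i assume "i < length ys"
      then have "i = 0 \<or> i = 1 \<or> i = 2" using ys(1) by auto
      moreover have "ys ! 0 = xs ! 0" "ys ! 1 = xs ! 1" "ys ! 2 = xs ! 2"
        using ys(2) unfolding m_def N_def by (simp_all only: nat.inject prod_encode_eq prod.inject)
      ultimately show "ys ! i = xs ! i" by blast
    qed (simp only: ys(1) len)
    then have code_xs: "(\<exists>ys. length ys = 3 \<and> m = N ys \<and> computes p [H ys] 1) \<longleftrightarrow> computes p [H xs] 1"
      using len m_def by metis
    have "(\<exists>\<tau>. (start m, \<tau>) \<in> run P) \<longleftrightarrow> (\<exists>ys. length ys = 3 \<and> m = N ys \<and> computes p [H ys] 1)"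
      unfolding P_def by (rule acceptor_halts_iff) (simp_all add: eN eH)
    also note code_xs
    finally show ?thesis .
  qed
  have cf: "is_cfca d (ca m g)" for g using is_cfca_ca by (simp add: ca_def)
  have dec: "computes p [H xs] (if same_stoch_map d 2 (ca m False) (ca m True) then 1 else 0)"
    using bspec[OF p, of "(ca m False, ca m True)"] cf unfolding mem_Collect_eq prod.case H by simp
  \<comment> \<open>The program accepts iff \<open>p\<close> claims that the laws agree, while
    acceptance makes them differ.\<close>
  have iff: "same_stoch_map d 2 (ca m False) (ca m True) \<longleftrightarrow> \<not> computes p [H xs] 1"
    using same_stoch_map_iff accept by (simp add: ca_def)
  show False
  proof (cases "computes p [H xs] 1")
    case True
    then have "computes p [H xs] 0" using dec iff by simp
    then show False using computes_unique[OF True] by fastforce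
  next
    case False
    then show False using dec iff by simp
  qed
qed

end
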